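(* Let $\alpha,\beta>0$ and assume that $H_1$ is separable. Then $(\mathcal{M}_1(\alpha,\beta,(A_0,A_1)),\tau_H)$ is metrisable and sequentially compact.
   Context: Hilbert spaces are complex; $L(K_0,K_1)$ denotes bounded linear operators, $L(K)=L(K,K)$. For $T\in L(K)$, $\operatorname{Re}T=\frac12(T+T^* )$, and $\operatorname{Re}T\ge c$ means $\operatorname{Re}\langle T\phi,\phi\rangle\ge c\|\phi\|^2$ for all $\phi$. Standing setting: $H_0,H_1,H_2$ are Hilbert spaces; $A_0:\operatorname{dom}(A_0)\subseteq H_0\to H_1$ and $A_1:\operatorname{dom}(A_1)\subseteq H_1\to H_2$ are densely defined closed linear operators; $(A_0,A_1)$ is closed and exact, i.e. $\operatorname{ran}(A_0)$, $\operatorname{ran}(A_1)$ are closed and $\operatorname{ran}(A_0)=\ker(A_1)$. Then $H_1=\operatorname{ran}(A_0)\oplus\operatorname{ran}(A_1^* )$ orthogonally. Let $\iota_0:\operatorname{ran}(A_0)\hookrightarrow H_1$ and $\iota_1:\operatorname{ran}(A_1^* )\hookrightarrow H_1$ be the canonical embeddings. For $a\in L(H_1)$ put $a_{jk}=\iota_j^*a\iota_k$ ($j,k\in\{0,1\}$); $a_{00}^{-1}$ means $(a_{00})^{-1}$ and $(a^{-1})_{11}^{-1}$ means $((a^{-1})_{11})^{-1}$. $\mathcal{M}(\alpha,\beta,(A_0,A_1))$ is the set of continuously invertible $a\in L(H_1)$ with $\operatorname{Re}a_{00}\ge\alpha$, $\operatorname{Re}a_{00}^{-1}\ge1/\beta$,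 $\operatorname{Re}(a^{-1})_{11}\ge1/\beta$, $\operatorname{Re}(a^{-1})_{11}^{-1}\ge\alpha$, and $\mathcal{M}_1(\alpha,\beta,(A_0,A_1))$ is the subset of those $a$ with $\|a_{00}^{-1}a_{01}\|\le\beta$ and $\|a_{10}a_{00}^{-1}\|\le\beta$. $\tau_H$ is the initial topology on $\mathcal{M}(\alpha,\beta,(A_0,A_1))$ (and the induced topology on $\mathcal{M}_1$) making the following four maps continuous, where $L_{\mathrm w}$ denotes bounded operators with the weak operator topology: $a\mapsto a_{00}^{-1}\in L_{\mathrm w}(\operatorname{ran}(A_0))$, $a\mapsto a_{10}a_{00}^{-1}\in L_{\mathrm w}(\operatorname{ran}(A_0),\operatorname{ran}(A_1^* ))$, $a\mapsto a_{00}^{-1}a_{01}\in L_{\mathrm w}(\operatorname{ran}(A_1^* ),\operatorname{ran}(A_0))$, $a\mapsto a_{11}-a_{10}a_{00}^{-1}a_{01}\in L_{\mathrm w}(\operatorname{ran}(A_1^* ))$. *)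

theory Defs
  imports "HOL-Analysis.Analysis"
begin

text \<open>Complex Hilbert spaces. The complex inner product is linear in its first argument. Its real
  part is the real inner product of the underlying real inner product space, so positive
  definiteness and the norm are inherited from \<^class>\<open>real_inner\<close>.\<close>

class complex_inner = real_inner +
  fixes scaleC :: "complex \<Rightarrow> 'a \<Rightarrow> 'a" (infixr "*\<^sub>C" 75)
    and cinner :: "'a \<Rightarrow> 'a \<Rightarrow> complex"
  assumes scaleC_add_right: "c *\<^sub>C (x + y) = c *\<^sub>C x + c *\<^sub>C y"
    and scaleC_add_left: "(c + d) *\<^sub>C x = c *\<^sub>C x + d *\<^sub>C x"
    and scaleC_scaleC: "c *\<^sub>C d *\<^sub>C x = (c * d) *\<^sub>C x"
    and scaleC_of_real: "complex_of_real r *\<^sub>C x = r *\<^sub>R x"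
    and cinner_commute: "cinner x y = cnj (cinner y x)"
    and cinner_add_left: "cinner (x + y) z = cinner x z + cinner y z"
    and cinner_scaleC_left: "cinner (c *\<^sub>C x) y = c * cinner x y"
    and Re_cinner: "Re (cinner x y) = inner x y"

class chilbert_space = complex_inner + complete_space

instantiation complex :: chilbert_space
begin

definition scaleC_complex :: "complex \<Rightarrow> complex \<Rightarrow> complex" where
  "scaleC_complex c x = c * x"

definition cinner_complex :: "complex \<Rightarrow> complex \<Rightarrow> complex" where
  "cinner_complex x y = x * cnj y"

instance
  by standard
    (auto simp: scaleC_complex_def cinner_complex_def inner_complex_def scaleR_conv_of_real
      algebra_simps)

end

text \<open>Unbounded operators are represented by their graphs: the domain and range of \<open>A\<close> are
  \<^term>\<open>Domain A\<close> and \<^term>\<open>Range A\<close>, and closedness of the operator is closedness of the graph.\<close>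

definition linear_operator :: "('a::complex_inner \<times> 'b::complex_inner) set \<Rightarrow> bool" where
  "linear_operator A \<longleftrightarrow> single_valued A \<and> (0, 0) \<in> A \<and>
     (\<forall>x y x' y'. (x, y) \<in> A \<longrightarrow> (x', y') \<in> A \<longrightarrow> (x + x', y + y') \<in> A) \<and>
     (\<forall>c x y. (x, y) \<in> A \<longrightarrow> (c *\<^sub>C x, c *\<^sub>C y) \<in> A)"

definition densely_defined :: "('a::complex_inner \<times> 'b::complex_inner) set \<Rightarrow> bool" where
  "densely_defined A \<longleftrightarrow> closure (Domain A) = UNIV"

definition op_ker :: "('a::complex_inner \<times> 'b::complex_inner) set \<Rightarrow> 'a set" where
  "op_ker A = {x. (x, 0) \<in> A}"

text \<open>The graph of the Hilbert space adjoint of a densely defined operator.\<close>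

definition op_adjoint :: "('a::complex_inner \<times> 'b::complex_inner) set \<Rightarrow> ('b \<times> 'a) set" where
  "op_adjoint A = {(y, z). \<forall>(x, w) \<in> A. cinner w y = cinner x z}"

definition closed_exact ::
  "('a::complex_inner \<times> 'b::complex_inner) set \<Rightarrow> ('b \<times> 'c::complex_inner) set \<Rightarrow> bool" where
  "closed_exact A0 A1 \<longleftrightarrow> closed (Range A0) \<and> closed (Range A1) \<and> Range A0 = op_ker A1"

text \<open>Bounded operators between closed subspaces \<open>U\<close> and \<open>V\<close> are functions that are extensional
  on \<open>U\<close>, so that two operators are equal iff they agree on \<open>U\<close>.\<close>

definition bounded_ops :: "'a::complex_inner set \<Rightarrow> 'b::complex_inner set \<Rightarrow> ('a \<Rightarrow> 'b) set" where
  "bounded_ops U V = {T \<in> U \<rightarrow>\<^sub>E V.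
     (\<forall>x\<in>U. \<forall>y\<in>U. T (x + y) = T x + T y) \<and>
     (\<forall>c. \<forall>x\<in>U. T (c *\<^sub>C x) = c *\<^sub>C T x) \<and>
     (\<exists>K. \<forall>x\<in>U. norm (T x) \<le> K * norm x)}"

definition bop_norm :: "'a::complex_inner set \<Rightarrow> ('a \<Rightarrow> 'b::complex_inner) \<Rightarrow> real" where
  "bop_norm U T = (SUP x\<in>U. norm (T x) / norm x)"

definition bop_adjoint ::
  "'a::complex_inner set \<Rightarrow> 'b::complex_inner set \<Rightarrow> ('a \<Rightarrow> 'b) \<Rightarrow> ('b \<Rightarrow> 'a)" where
  "bop_adjoint U V T =
     (THE S. S \<in> bounded_ops V U \<and> (\<forall>x\<in>U. \<forall>y\<in>V. cinner (T x) y = cinner x (S y)))"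

text \<open>The inverse \<open>V \<rightarrow> U\<close> of an operator \<open>T : U \<rightarrow> V\<close>; meaningful if \<open>T\<close> is a bijection of \<open>U\<close>
  onto \<open>V\<close>.\<close>

definition bop_inv :: "'a set \<Rightarrow> 'b set \<Rightarrow> ('a \<Rightarrow> 'b) \<Rightarrow> ('b \<Rightarrow> 'a)" where
  "bop_inv U V T = restrict (inv_into U T) V"

definition continuously_invertible ::
  "'a::complex_inner set \<Rightarrow> 'b::complex_inner set \<Rightarrow> ('a \<Rightarrow> 'b) \<Rightarrow> bool" where
  "continuously_invertible U V T \<longleftrightarrow> bij_betw T U V \<and> bop_inv U V T \<in> bounded_ops V U"

definition Re_ge :: "'a::complex_inner set \<Rightarrow> ('a \<Rightarrow> 'a) \<Rightarrow> real \<Rightarrow> bool" where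
  "Re_ge U T c \<longleftrightarrow> (\<forall>x\<in>U. Re (cinner (T x) x) \<ge> c * (norm x)\<^sup>2)"

definition embed :: "'a set \<Rightarrow> 'a \<Rightarrow> 'a" where
  "embed U = (\<lambda>x\<in>U. x)"

text \<open>\<open>block V U a\<close> is \<open>\<iota>\<^sub>V\<^sup>* a \<iota>\<^sub>U : U \<rightarrow> V\<close> for the embeddings \<open>\<iota>\<^sub>U\<close>, \<open>\<iota>\<^sub>V\<close> of \<open>U\<close>, \<open>V\<close> into the
  whole space.\<close>

definition block :: "'a::complex_inner set \<Rightarrow> 'a set \<Rightarrow> ('a \<Rightarrow> 'a) \<Rightarrow> ('a \<Rightarrow> 'a)" where
  "block V U a = compose U (bop_adjoint V UNIV (embed V)) (compose U a (embed U))"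

definition initial_topology :: "'a set \<Rightarrow> (('a \<Rightarrow> 'b) \<times> 'b topology) set \<Rightarrow> 'a topology" where
  "initial_topology S F =
     topology_generated_by (insert S {{a \<in> S. f a \<in> W} |f Y W. (f, Y) \<in> F \<and> openin Y W})"

definition weak_op_topology ::
  "'a::complex_inner set \<Rightarrow> 'b::complex_inner set \<Rightarrow> ('a \<Rightarrow> 'b) topology" where
  "weak_op_topology U V =
     initial_topology (bounded_ops U V) {(\<lambda>T. cinner (T x) y, euclidean) |x y. x \<in> U \<and> y \<in> V}"

definition seq_compact_space :: "'a topology \<Rightarrow> bool" where
  "seq_compact_space X \<longleftrightarrow>
     (\<forall>f :: nat \<Rightarrow> 'a. (\<forall>n. f n \<in> topspace X) \<longrightarrow>
        (\<exists>l r. l \<in> topspace X \<and> strict_mono r \<and> limitin X (f \<circ> r) l sequentially))"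

text \<open>In the following, \<open>R0\<close> is the range of \<open>A\<^sub>0\<close> and \<open>R1\<close> the range of \<open>A\<^sub>1\<^sup>*\<close>. For \<open>\<alpha>, \<beta> > 0\<close> the
  inverses of \<open>a\<^sub>0\<^sub>0\<close> and \<open>(a\<^sup>-\<^sup>1)\<^sub>1\<^sub>1\<close> exist because these operators are coercive.\<close>

definition M_class ::
  "real \<Rightarrow> real \<Rightarrow> ('a::complex_inner \<times> 'b::complex_inner) set \<Rightarrow>
    ('b \<times> 'c::complex_inner) set \<Rightarrow> ('b \<Rightarrow> 'b) set" where
  "M_class \<alpha> \<beta> A0 A1 =
     (let R0 = Range A0; R1 = Range (op_adjoint A1) in
      {a \<in> bounded_ops UNIV UNIV. continuously_invertible UNIV UNIV a \<and>
         Re_ge R0 (block R0 R0 a) \<alpha> \<and>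
         Re_ge R0 (bop_inv R0 R0 (block R0 R0 a)) (1 / \<beta>) \<and>
         Re_ge R1 (block R1 R1 (bop_inv UNIV UNIV a)) (1 / \<beta>) \<and>
         Re_ge R1 (bop_inv R1 R1 (block R1 R1 (bop_inv UNIV UNIV a))) \<alpha>})"

definition M1_class ::
  "real \<Rightarrow> real \<Rightarrow> ('a::complex_inner \<times> 'b::complex_inner) set \<Rightarrow>
    ('b \<times> 'c::complex_inner) set \<Rightarrow> ('b \<Rightarrow> 'b) set" where
  "M1_class \<alpha> \<beta> A0 A1 =
     (let R0 = Range A0; R1 = Range (op_adjoint A1) in
      {a \<in> M_class \<alpha> \<beta> A0 A1.
         bop_norm R1 (compose R1 (bop_inv R0 R0 (block R0 R0 a)) (block R0 R1 a)) \<le> \<beta> \<and>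
         bop_norm R0 (compose R0 (block R1 R0 a) (bop_inv R0 R0 (block R0 R0 a))) \<le> \<beta>})"

definition tau_H ::
  "real \<Rightarrow> real \<Rightarrow> ('a::complex_inner \<times> 'b::complex_inner) set \<Rightarrow>
    ('b \<times> 'c::complex_inner) set \<Rightarrow> ('b \<Rightarrow> 'b) topology" where
  "tau_H \<alpha> \<beta> A0 A1 =
     (let R0 = Range A0; R1 = Range (op_adjoint A1);
          inv00 = (\<lambda>a. bop_inv R0 R0 (block R0 R0 a)) in
      initial_topology (M_class \<alpha> \<beta> A0 A1)
       {(\<lambda>a. inv00 a, weak_op_topology R0 R0),
        (\<lambda>a. compose R0 (block R1 R0 a) (inv00 a), weak_op_topology R0 R1),
        (\<lambda>a. compose R1 (inv00 a) (block R0 R1 a), weak_op_topology R1 R0),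
        (\<lambda>a. \<lambda>x\<in>R1. block R1 R1 a x - block R1 R0 a (inv00 a (block R0 R1 a x)),
          weak_op_topology R1 R1)})"

end

theory Submission
  imports Defs
begin

text \<open>Write \<open>R0\<close> and \<open>R1\<close> for the ranges of \<open>A0\<close> and of the adjoint of \<open>A1\<close>. By the closed range
  theorem \<open>R1\<close> is the orthogonal complement of \<open>R0 = ker A1\<close>; let \<open>P\<close> be the orthogonal projection
  onto \<open>R0\<close> and \<open>Q = 1 - P\<close>.

  The four maps that define \<open>tau_H\<close> are, up to a sign, the blocks of one operator \<open>T\<close>, the partial
  inverse of \<open>a\<close>: whenever \<open>a x = y\<close>, \<open>T\<close> sends \<open>P y + Q x\<close> to \<open>P x + Q y\<close>. This description of \<open>T\<close>
  is symmetric in \<open>a\<close> and \<open>T\<close>, so \<open>a\<close> is recovered from \<open>T\<close> by the same recipe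
  (\<open>partial_inverse_partial_inverse\<close>). Hence \<open>tau_H\<close> on \<open>M1_class\<close> is nothing but the weak operator
  topology, transported by the bijection \<open>a \<mapsto> T\<close> onto a set of bounded operators
  (\<open>continuous_map_tau_H_coefficient\<close>, \<open>continuous_map_into_tau_H\<close>).

  That set, \<open>partial_inverse_class\<close>, consists of the operators that satisfy certain inequalities
  (\<open>M1_class_iff\<close>). The substitution \<open>x = P (T u)\<close> turns the condition \<open>Re a\<^sub>0\<^sub>0 \<ge> \<alpha>\<close> into
  \<open>\<alpha> \<parallel>P (T u)\<parallel>\<^sup>2 \<le> Re \<langle>T u, u\<rangle>\<close>, and the condition on \<open>(a\<^sup>-\<^sup>1)\<^sub>1\<^sub>1\<close> is treated likewise. In this form the
  left-hand sides are weakly lower semicontinuous and the right-hand sides weakly continuous, so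
  the conditions survive weak limits. They also bound the norm of \<open>T\<close> uniformly.

  A norm bounded, weakly sequentially closed set of operators on a separable Hilbert space is
  embedded as a compact subset into a countable product of intervals by its matrix coefficients with
  respect to a countable dense set (\<open>weak_coordinates\<close>). Both claims follow.

  The real part of the complex inner product is the real inner product, and its imaginary part is
  a real inner product as well (\<open>cinner_eq_Complex_inner\<close>). So the analysis is done in real Hilbert
  spaces, and complex linearity is carried along separately.\<close>

section \<open>Geometry of real Hilbert spaces\<close>

text \<open>By the parallelogram law, elements of almost minimal norm in a decreasing sequence of
  convex sets are close to each other, because their midpoint cannot be much shorter. With a
  constant sequence this yields the projection theorem; with a non-constant one it replaces
  weak compactness of balls in the proof of the closed range theorem.\<close>

lemma decreasing_convex_almost_minimal_Cauchy:
  fixes C :: "nat \<Rightarrow> 'a::real_inner set"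
  assumes cvx: "\<And>n. convex (C n)"
    and dec: "\<And>m n. m \<le> n \<Longrightarrow> C n \<subseteq> C m"
    and bd: "\<And>n. \<exists>x\<in>C n. norm x \<le> B"
  obtains x where "\<And>n. x n \<in> C n" "Cauchy x"
    "\<And>n y. y \<in> C n \<Longrightarrow> (norm (x n))\<^sup>2 < (norm y)\<^sup>2 + 1 / real (Suc n)"
proof -
  define d where "d n = (INF y\<in>C n. (norm y)\<^sup>2)" for n
  have ne: "C n \<noteq> {}" for n using bd[of n] by auto
  have bdd: "bdd_below ((\<lambda>y. (norm y)\<^sup>2) ` C n)" for n by (rule bdd_belowI[of _ 0]) auto
  have d_le: "d n \<le> (norm y)\<^sup>2" if "y \<in> C n" for n y
    unfolding d_def using bdd that by (rule cINF_lower)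
  have "\<exists>y\<in>C n. (norm y)\<^sup>2 < d n + 1 / real (Suc n)" for n
    using cInf_lessD[of "(\<lambda>y. (norm y)\<^sup>2) ` C n" "d n + 1 / real (Suc n)"] ne[of n]
    by (auto simp: d_def)
  then obtain x where xC: "\<And>n. x n \<in> C n" and xd: "\<And>n. (norm (x n))\<^sup>2 < d n + 1 / real (Suc n)"
    by metis
  have d_mono: "d m \<le> d n" if "m \<le> n" for m n
    unfolding d_def using ne[of n] bdd[of m] dec[OF that] by (intro cINF_superset_mono) auto
  have d_bound: "d n \<le> B\<^sup>2" for n
  proof -
    obtain y where "y \<in> C n" "norm y \<le> B" using bd by blast
    then show ?thesis using d_le[of y n] power_mono[of "norm y" B 2] by auto
  qed
  have "Cauchy d"
    using incseq_convergent[of d "B\<^sup>2"] d_mono d_bound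
    by (metis incseq_def convergent_Cauchy convergent_def)
  have close: "(norm (x m - x n))\<^sup>2 \<le> 2 * (d n - d m) + 4 * (1 / real (Suc m))" if "m \<le> n" for m n
  proof -
    define e where "e k = 1 / real (Suc k)" for k
    have "(1/2) *\<^sub>R x m + (1/2) *\<^sub>R x n \<in> C m"
      using xC dec[OF that] by (intro convexD[OF cvx]) auto
    then have "d m \<le> (norm ((1/2) *\<^sub>R (x m + x n)))\<^sup>2" using d_le by (simp add: scaleR_add_right)
    then have "4 * d m \<le> (norm (x m + x n))\<^sup>2" by (simp add: power_mult_distrib power2_eq_square)
    moreover have "(norm (x m - x n))\<^sup>2 + (norm (x m + x n))\<^sup>2 = 2 * (norm (x m))\<^sup>2 + 2 * (norm (x n))\<^sup>2"
      by (simp add: power2_norm_eq_inner inner_simps inner_commute)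
    moreover have "e n \<le> e m" using that by (simp add: e_def frac_le)
    ultimately show ?thesis using xd[of m] xd[of n] unfolding e_def[symmetric] by argo
  qed
  have "Cauchy x"
  proof (rule CauchyI)
    fix e :: real assume e: "e > 0"
    from CauchyD[OF \<open>Cauchy d\<close>, of "e\<^sup>2 / 4"] e
    obtain N where N: "\<And>m n. m \<ge> N \<Longrightarrow> n \<ge> N \<Longrightarrow> \<bar>d m - d n\<bar> < e\<^sup>2 / 4" by auto
    obtain M :: nat where M: "real M > 8 / e\<^sup>2" using reals_Archimedean2 by blast
    have *: "norm (x m - x n) < e" if "m \<ge> max M N" "m \<le> n" for m n
    proof -
      have "real (Suc m) > 8 / e\<^sup>2" using that(1) M by linarith
      then have "4 * (1 / real (Suc m)) < e\<^sup>2 / 2" using e by (simp add: field_simps)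
      moreover have "\<bar>d n - d m\<bar> < e\<^sup>2 / 4" using N[of n m] that by simp
      then have "d n - d m < e\<^sup>2 / 4" by (rule order_le_less_trans[OF abs_ge_self])
      ultimately have "(norm (x m - x n))\<^sup>2 < e\<^sup>2" using close[OF that(2)] by argo
      then show ?thesis using e by (simp add: power2_less_imp_less)
    qed
    show "\<exists>M. \<forall>m\<ge>M. \<forall>n\<ge>M. norm (x m - x n) < e"
      using * by (intro exI[of _ "max M N"]) (metis nle_le norm_minus_commute)
  qed
  moreover have "(norm (x n))\<^sup>2 < (norm y)\<^sup>2 + 1 / real (Suc n)" if "y \<in> C n" for n y
    using xd[of n] d_le[OF that] by linarith
  ultimately show thesis using that xC by blast
qed

lemma orthogonal_decomposition_exists:
  fixes V :: "'a::{real_inner, complete_space} set"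
  assumes "subspace V" "closed V"
  obtains v where "v \<in> V" "\<And>w. w \<in> V \<Longrightarrow> inner (x - v) w = 0"
proof -
  let ?C = "(\<lambda>v. x - v) ` V"
  have "convex ?C"
    using convex_affinity[OF subspace_imp_convex[OF assms(1)], of x "-1"] by simp
  moreover have "\<exists>y\<in>?C. norm y \<le> norm x" using subspace_0[OF assms(1)] by (force intro: bexI[of _ 0])
  ultimately obtain y where y: "\<And>n::nat. y n \<in> ?C" "Cauchy y"
    and min: "\<And>n z. z \<in> ?C \<Longrightarrow> (norm (y n))\<^sup>2 < (norm z)\<^sup>2 + 1 / real (Suc n)"
    using decreasing_convex_almost_minimal_Cauchy[of "\<lambda>_. ?C" "norm x"] by blast
  obtain l where l: "y \<longlonglongrightarrow> l" using y(2) Cauchy_convergent convergent_def by blast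
  have "x - y n \<in> V" for n using y(1)[of n] by auto
  moreover have "(\<lambda>n. x - y n) \<longlonglongrightarrow> x - l" by (intro tendsto_intros l)
  ultimately have "x - l \<in> V" by (rule closed_sequentially[OF assms(2)])
  have le: "(norm l)\<^sup>2 \<le> (norm z)\<^sup>2" if "z \<in> ?C" for z
  proof (rule LIMSEQ_le)
    show "(\<lambda>n. (norm (y n))\<^sup>2) \<longlonglongrightarrow> (norm l)\<^sup>2" using l by (intro tendsto_intros)
    show "(\<lambda>n. (norm z)\<^sup>2 + 1 / real (Suc n)) \<longlonglongrightarrow> (norm z)\<^sup>2"
      using tendsto_add[OF tendsto_const LIMSEQ_inverse_real_of_nat, of "(norm z)\<^sup>2"]
      by (simp add: inverse_eq_divide)
  qed (use min[OF that] in \<open>auto intro: less_imp_le\<close>)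
  have "inner l w = 0" if "w \<in> V" for w
  proof (rule ccontr)
    assume nz: "inner l w \<noteq> 0"
    then have "w \<noteq> 0" by auto
    \<comment> \<open>\<open>l - t *\<^sub>R w\<close> would be shorter than the minimiser \<open>l\<close>.\<close>
    define t where "t = inner l w / inner w w"
    have "x - l + t *\<^sub>R w \<in> V" using \<open>x - l \<in> V\<close> that assms(1) by (simp add: subspace_add subspace_scale)
    then have "l - t *\<^sub>R w \<in> ?C" by (intro image_eqI[of _ _ "x - l + t *\<^sub>R w"]) auto
    from le[OF this] have "2 * t * inner l w \<le> t * (t * inner w w)"
      by (simp add: power2_norm_eq_inner inner_simps inner_commute algebra_simps)
    moreover have "t * inner w w = inner l w" using \<open>w \<noteq> 0\<close> by (simp add: t_def)
    ultimately have "t * inner l w \<le> 0" by simp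
    moreover have "t * inner l w > 0"
      using nz \<open>w \<noteq> 0\<close> by (simp add: t_def flip: power2_eq_square)
    ultimately show False by simp
  qed
  then show thesis using \<open>x - l \<in> V\<close> by (intro that[of "x - l"]) auto
qed

lemma Riesz_representation:
  fixes f :: "'a::{real_inner, complete_space} \<Rightarrow> real"
  assumes "bounded_linear f"
  obtains y where "\<And>x. f x = inner x y"
proof (cases "\<forall>x. f x = 0")
  case True
  then show thesis by (intro that[of 0]) auto
next
  case False
  interpret f: bounded_linear f by fact
  obtain a where a: "f a \<noteq> 0" using False by blast
  let ?N = "{x. f x = 0}"
  have "subspace ?N" by (auto simp: subspace_def f.add f.scaleR f.zero)
  moreover have "closed ?N" by (intro closed_Collect_eq continuous_intros linear_continuous_on assms)
  ultimately obtain v where v: "f v = 0" "\<And>w. f w = 0 \<Longrightarrow> inner (a - v) w = 0"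
    using orthogonal_decomposition_exists[of ?N a] by auto
  define u where "u = a - v"
  have fu: "f u \<noteq> 0" using a v(1) by (simp add: u_def f.diff)
  then have "u \<noteq> 0" by (auto simp: f.zero)
  have "f x = inner x ((f u / inner u u) *\<^sub>R u)" for x
  proof -
    have "f (x - (f x / f u) *\<^sub>R u) = 0" using fu by (simp add: f.diff f.scaleR)
    from v(2)[OF this] have "inner u x = (f x / f u) * inner u u" by (simp add: u_def inner_diff_right)
    then show ?thesis using fu \<open>u \<noteq> 0\<close> by (simp add: inner_commute field_simps)
  qed
  then show thesis using that by blast
qed

lemma bounded_bilinear_form_representation:
  fixes b :: "'a::real_normed_vector \<Rightarrow> 'b::{real_inner, complete_space} \<Rightarrow> real"
  assumes "bounded_bilinear b"
  obtains T where "bounded_linear T" "\<And>x y. b x y = inner (T x) y"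
proof -
  interpret b: bounded_bilinear b by fact
  have "\<exists>z. \<forall>y. b x y = inner z y" for x
    using Riesz_representation[OF b.bounded_linear_right, of x] by (metis inner_commute)
  then obtain T where T: "\<And>x y. b x y = inner (T x) y" by metis
  obtain K where K: "K > 0" "\<And>x y. norm (b x y) \<le> norm x * norm y * K"
    using b.pos_bounded by blast
  have eqI: "u = v" if "\<And>y. inner u y = inner v y" for u v :: 'b
    using that[of "u - v"] inner_eq_zero_iff[of "u - v"] by (simp add: inner_diff_left)
  have "bounded_linear T"
  proof
    show "T (x + y) = T x + T y" for x y
      by (rule eqI) (simp add: inner_add_left b.add_left flip: T)
    show "T (r *\<^sub>R x) = r *\<^sub>R T x" for r x
      by (rule eqI) (simp add: b.scaleR_left flip: T)
    have "norm (T x) \<le> norm x * K" for x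
    proof (cases "T x = 0")
      case True
      then show ?thesis using K(1) by simp
    next
      case False
      have "norm (T x) * norm (T x) \<le> norm x * K * norm (T x)"
        using K(2)[of x "T x"] by (simp add: T power2_norm_eq_inner[symmetric] power2_eq_square mult_ac)
      then show ?thesis using False by simp
    qed
    then show "\<exists>K. \<forall>x. norm (T x) \<le> norm x * K" by blast
  qed
  then show thesis using that T by blast
qed

text \<open>The Lax-Milgram theorem: for small \<open>\<rho>\<close> the map \<open>x \<mapsto> x - \<rho> (T x - y)\<close> is a contraction,
  and its fixed point solves \<open>T x = y\<close>.\<close>

lemma coercive_imp_bij:
  fixes T :: "'a::{real_inner, complete_space} \<Rightarrow> 'a"
  assumes "bounded_linear T" and c: "c > 0" and coer: "\<And>x. inner (T x) x \<ge> c * (norm x)\<^sup>2"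
  shows "bij T"
proof -
  interpret T: bounded_linear T by fact
  have inj: "inj T"
  proof (rule injI)
    fix x y assume "T x = T y"
    then have "c * (norm (x - y))\<^sup>2 \<le> 0" using coer[of "x - y"] by (simp add: T.diff)
    then show "x = y" using c by (simp add: mult_le_0_iff)
  qed
  have "\<exists>x. T x = y" for y
  proof -
    obtain M0 where M0: "M0 > 0" "\<And>x. norm (T x) \<le> norm x * M0" using T.pos_bounded by blast
    define M where "M = max M0 c"
    have M: "norm (T x) \<le> M * norm x" "M > 0" "c \<le> M" for x
      using M0(2)[of x] c mult_right_mono[of M0 M "norm x"] by (auto simp: M_def mult.commute)
    \<comment> \<open>This \<open>\<rho>\<close> minimises \<open>1 - 2 * \<rho> * c + \<rho>\<^sup>2 * M\<^sup>2\<close>, the bound for the squared contraction factor.\<close>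
    define \<rho> where "\<rho> = c / M\<^sup>2"
    define q where "q = sqrt (1 - c\<^sup>2 / M\<^sup>2)"
    have "c\<^sup>2 \<le> M\<^sup>2" using M(3) c by (intro power_mono) auto
    then have q: "0 \<le> q" "q < 1" "q\<^sup>2 = 1 - c\<^sup>2 / M\<^sup>2" using c M(2) by (auto simp: q_def)
    have "dist (x - \<rho> *\<^sub>R (T x - y)) (z - \<rho> *\<^sub>R (T z - y)) \<le> q * dist x z" for x z
    proof -
      let ?u = "x - z"
      have "(norm (u - \<rho> *\<^sub>R T u))\<^sup>2 = (norm u)\<^sup>2 - 2 * \<rho> * inner (T u) u + \<rho>\<^sup>2 * (norm (T u))\<^sup>2" for u
        unfolding power2_norm_eq_inner
        by (simp add: inner_diff_left inner_diff_right inner_commute power2_eq_square algebra_simps)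
      then have "(norm (?u - \<rho> *\<^sub>R T ?u))\<^sup>2 =
          (norm ?u)\<^sup>2 - 2 * \<rho> * inner (T ?u) ?u + \<rho>\<^sup>2 * (norm (T ?u))\<^sup>2" .
      also have "\<dots> \<le> (norm ?u)\<^sup>2 - 2 * \<rho> * (c * (norm ?u)\<^sup>2) + \<rho>\<^sup>2 * (M\<^sup>2 * (norm ?u)\<^sup>2)"
      proof (intro add_mono diff_mono mult_left_mono coer order_refl)
        show "(norm (T ?u))\<^sup>2 \<le> M\<^sup>2 * (norm ?u)\<^sup>2"
          using power_mono[OF M(1)[of ?u], of 2] by (simp add: power_mult_distrib)
      qed (use c M(2) in \<open>auto simp: \<rho>_def\<close>)
      also have "\<dots> = q\<^sup>2 * (norm ?u)\<^sup>2"
        unfolding q(3) using M(2) by (simp add: \<rho>_def field_simps) (simp add: power2_eq_square)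
      finally have "norm (?u - \<rho> *\<^sub>R T ?u) \<le> q * norm ?u"
        using q(1) by - (rule power2_le_imp_le, auto simp: power_mult_distrib)
      then show ?thesis by (simp add: dist_norm T.diff algebra_simps)
    qed
    then obtain x where "x - \<rho> *\<^sub>R (T x - y) = x"
      using banach_fix_type[OF q(1,2), of "\<lambda>x. x - \<rho> *\<^sub>R (T x - y)"] by blast
    moreover have "\<rho> \<noteq> 0" using c M(2) by (simp add: \<rho>_def)
    ultimately show ?thesis by auto
  qed
  then show ?thesis using inj by (auto simp: bij_def surj_def) metis
qed

section \<open>Bounded preimages under closed operators\<close>

text \<open>The points \<open>x\<close> of the ball whose images come within \<open>1 / (n + 1)\<close> of a limit point \<open>w\<close> form a
  decreasing sequence of convex sets. Elements of almost minimal norm in them converge, and since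
  the graph is closed their limit is mapped to \<open>w\<close>.\<close>

lemma closed_operator_image_cball_closed:
  fixes A :: "('a::{real_inner, complete_space} \<times> 'b::real_normed_vector) set"
  assumes A: "subspace A" "closed A"
  shows "closed {w. \<exists>x. (x, w) \<in> A \<and> norm x \<le> r}"
  unfolding closed_sequential_limits
proof (intro allI impI, elim conjE)
  fix f w assume f: "\<forall>n. f n \<in> {w. \<exists>x. (x, w) \<in> A \<and> norm x \<le> r}" and lim: "f \<longlonglongrightarrow> w"
  define C where "C n = {x. norm x \<le> r \<and> (\<exists>v. (x, v) \<in> A \<and> norm (v - w) \<le> 1 / real (Suc n))}" for n
  have "convex (C n)" for n
  proof (rule convexI)
    fix x y and s t :: real assume x: "x \<in> C n" and y: "y \<in> C n"
      and st: "0 \<le> s" "0 \<le> t" "s + t = 1"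
    obtain v where v: "norm x \<le> r" "(x, v) \<in> A" "norm (v - w) \<le> 1 / real (Suc n)"
      using x by (auto simp: C_def)
    obtain v' where v': "norm y \<le> r" "(y, v') \<in> A" "norm (v' - w) \<le> 1 / real (Suc n)"
      using y by (auto simp: C_def)
    have "norm (s *\<^sub>R x + t *\<^sub>R y) \<le> s * r + t * r"
      using st v(1) v'(1) by (intro norm_triangle_le add_mono) (auto simp: mult_left_mono)
    moreover have "(s *\<^sub>R x + t *\<^sub>R y, s *\<^sub>R v + t *\<^sub>R v') \<in> A"
      using subspace_add[OF A(1) subspace_scale[OF A(1) v(2), of s] subspace_scale[OF A(1) v'(2), of t]]
      by simp
    moreover have "s *\<^sub>R v + t *\<^sub>R v' - w = s *\<^sub>R (v - w) + t *\<^sub>R (v' - w)"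
      using st(3) by (simp add: algebra_simps flip: scaleR_add_left)
    then have "norm (s *\<^sub>R v + t *\<^sub>R v' - w) \<le> s * (1 / real (Suc n)) + t * (1 / real (Suc n))"
      using mult_left_mono[OF v(3) st(1)] mult_left_mono[OF v'(3) st(2)] st
      by (simp del: of_nat_Suc add: norm_triangle_le)
    ultimately show "s *\<^sub>R x + t *\<^sub>R y \<in> C n"
      using st(3) unfolding C_def by (metis (mono_tags, lifting) distrib_right mem_Collect_eq mult_1)
  qed
  moreover have "C n \<subseteq> C m" if "m \<le> n" for m n
  proof -
    have "1 / real (Suc n) \<le> 1 / real (Suc m)" using that by (simp add: frac_le)
    then show ?thesis unfolding C_def using order_trans by blast
  qed
  moreover have "\<exists>x\<in>C n. norm x \<le> r" for n
  proof -
    obtain k where "dist (f k) w < 1 / real (Suc n)"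
      using lim[unfolded lim_sequentially] by (metis of_nat_0_less_iff order_refl zero_less_Suc zero_less_divide_1_iff)
    moreover obtain x where "(x, f k) \<in> A" "norm x \<le> r" using f by blast
    ultimately show ?thesis unfolding C_def dist_norm by (auto intro: less_imp_le)
  qed
  ultimately obtain x where x: "\<And>n. x n \<in> C n" "Cauchy x"
    using decreasing_convex_almost_minimal_Cauchy[of C r] by metis
  obtain l where l: "x \<longlonglongrightarrow> l" using x(2) Cauchy_convergent convergent_def by blast
  obtain v where v: "\<And>n. (x n, v n) \<in> A" "\<And>n. norm (v n - w) \<le> 1 / real (Suc n)"
    using x(1) unfolding C_def by (auto simp del: of_nat_Suc) metis
  have "(\<lambda>n. v n - w) \<longlonglongrightarrow> 0"
    by (rule Lim_null_comparison[OF always_eventually LIMSEQ_inverse_real_of_nat])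
      (use v(2) in \<open>simp add: inverse_eq_divide\<close>)
  then have "v \<longlonglongrightarrow> w" by (simp add: LIM_zero_iff)
  then have "(l, w) \<in> A" by (rule closed_sequentially[OF A(2) v(1) tendsto_Pair[OF l]])
  moreover have "norm l \<le> r"
    using x(1) by (intro Lim_bounded[OF tendsto_norm[OF l]]) (auto simp: C_def)
  ultimately show "w \<in> {w. \<exists>x. (x, w) \<in> A \<and> norm x \<le> r}" by blast
qed

text \<open>The range is the union of the images of the balls of integer radius. These are closed, so
  by Baire's theorem one of them contains a relatively open subset of the range; translating it
  to the origin bounds preimages of small vectors.\<close>

lemma closed_operator_bounded_preimages:
  fixes A :: "('a::{real_inner, complete_space} \<times> 'b::{real_normed_vector, complete_space}) set"
  assumes A: "subspace A" "closed A" "closed (Range A)"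
  obtains C where "\<And>w. w \<in> Range A \<Longrightarrow> \<exists>x. (x, w) \<in> A \<and> norm x \<le> C * norm w"
proof -
  define K where "K n = {w. \<exists>x. (x, w) \<in> A \<and> norm x \<le> real n}" for n
  have zero: "(0, 0) \<in> A" using subspace_0[OF A(1)] by (simp add: zero_prod_def)
  have KR: "K n \<subseteq> Range A" for n by (auto simp: K_def)
  have un: "\<Union>(range K) = Range A"
  proof (intro equalityI subsetI)
    fix w assume "w \<in> Range A"
    then obtain x where "(x, w) \<in> A" by blast
    moreover obtain n where "norm x \<le> real n" using real_arch_simple by blast
    ultimately show "w \<in> \<Union>(range K)" by (auto simp: K_def)
  qed (use KR in auto)
  have "completely_metrizable_space (top_of_set (Range A))"
    using A(3) by (intro completely_metrizable_space_closedin completely_metrizable_space_euclidean) auto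
  moreover have "closedin (top_of_set (Range A)) (K n)" for n
    using closed_operator_image_cball_closed[OF A(1,2), of "real n"] KR[of n]
    by (auto simp: K_def closed_subset)
  moreover have "top_of_set (Range A) interior_of \<Union>(range K) \<noteq> {}"
    using zero by (auto simp: un interior_of_topspace[of "top_of_set (Range A)", simplified])
  ultimately obtain n where "top_of_set (Range A) interior_of (K n) \<noteq> {}"
    using Baire_category_alt[of "top_of_set (Range A)" "range K"] by auto
  then obtain w0 T where T: "openin (top_of_set (Range A)) T" "w0 \<in> T" "T \<subseteq> K n"
    by (auto simp: interior_of_def)
  then obtain e where e: "e > 0" "\<And>w. w \<in> Range A \<Longrightarrow> dist w w0 < e \<Longrightarrow> w \<in> T"
    by (auto simp: openin_euclidean_subtopology_iff)
  obtain x0 where x0: "(x0, w0) \<in> A" "norm x0 \<le> real n" using T by (auto simp: K_def)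
  have "\<exists>x. (x, w) \<in> A \<and> norm x \<le> (4 * real n / e) * norm w" if w: "w \<in> Range A" for w
  proof (cases "w = 0")
    case True
    then show ?thesis using zero by (intro exI[of _ 0]) simp
  next
    case False
    define s where "s = e / (2 * norm w)"
    have s: "s > 0" using False e(1) by (simp add: s_def)
    obtain x where "(x, w) \<in> A" using w by blast
    then have "(x0 + s *\<^sub>R x, w0 + s *\<^sub>R w) \<in> A"
      using subspace_add[OF A(1) x0(1) subspace_scale[OF A(1), of "(x, w)" s]] by simp
    moreover have "dist (w0 + s *\<^sub>R w) w0 < e" using e(1) False by (simp add: dist_norm s_def)
    ultimately have "w0 + s *\<^sub>R w \<in> K n" using e(2) T(3) by blast
    then obtain x1 where x1: "(x1, w0 + s *\<^sub>R w) \<in> A" "norm x1 \<le> real n" by (auto simp: K_def)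
    have "((1/s) *\<^sub>R (x1 - x0), w) \<in> A"
      using subspace_scale[OF A(1) subspace_diff[OF A(1) x1(1) x0(1)], of "1/s"] s by simp
    moreover have "norm (x1 - x0) \<le> 2 * real n" using norm_triangle_ineq4[of x1 x0] x0(2) x1(2) by simp
    then have "norm ((1/s) *\<^sub>R (x1 - x0)) \<le> (1/s) * (2 * real n)"
      unfolding norm_scaleR using s by (intro mult_mono) auto
    then have "norm ((1/s) *\<^sub>R (x1 - x0)) \<le> (4 * real n / e) * norm w"
      using e(1) False by (simp add: s_def mult_ac)
    ultimately show ?thesis by blast
  qed
  then show thesis using that by blast
qed

section \<open>Complex subspaces and complex linear operators\<close>

text \<open>With this formula statements about \<^const>\<open>cinner\<close> reduce to statements about the real inner
  product, applied to \<open>x\<close> and to \<open>\<i> *\<^sub>C x\<close>.\<close>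

lemma cinner_eq_Complex_inner:
  "cinner x y = Complex (inner x y) (- inner (\<i> *\<^sub>C x) (y :: 'a::complex_inner))"
  using Re_cinner[of "\<i> *\<^sub>C x" y]
  by (simp add: complex_eq_iff Re_cinner cinner_scaleC_left)

lemma cinner_scaleC_right: "cinner x (c *\<^sub>C y) = cnj c * cinner x (y :: 'a::complex_inner)"
  by (metis cinner_commute cinner_scaleC_left complex_cnj_mult)

lemma inner_scaleC_left: "inner (c *\<^sub>C x) y = inner x (cnj c *\<^sub>C (y :: 'a::complex_inner))"
  by (simp add: cinner_scaleC_left cinner_scaleC_right flip: Re_cinner)

lemma norm_scaleC: "norm (c *\<^sub>C x) = cmod c * norm (x :: 'a::complex_inner)"
proof -
  have "(norm (c *\<^sub>C x))\<^sup>2 = Re (c * cnj c * cinner x x)"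
    by (simp only: power2_norm_eq_inner Re_cinner[symmetric] cinner_scaleC_left cinner_scaleC_right mult_ac)
  also have "\<dots> = (cmod c * norm x)\<^sup>2"
    by (simp add: complex_norm_square[symmetric] power_mult_distrib power2_norm_eq_inner mult_ac flip: Re_cinner of_real_power)
  finally show ?thesis by (simp add: power2_eq_iff_nonneg)
qed

lemma scaleC_zero_right [simp]: "c *\<^sub>C 0 = (0 :: 'a::complex_inner)"
  using norm_scaleC[of c "0 :: 'a"] by simp

lemma scaleC_minus_right: "c *\<^sub>C (- x) = - (c *\<^sub>C (x :: 'a::complex_inner))"
  using scaleC_add_right[of c x "- x"] by (simp add: eq_neg_iff_add_eq_0 add.commute)

lemma scaleC_diff_right: "c *\<^sub>C (x - y) = c *\<^sub>C x - c *\<^sub>C (y :: 'a::complex_inner)"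
  using scaleC_add_right[of c x "- y"] by (simp add: scaleC_minus_right)

definition csubspace :: "'a::complex_inner set \<Rightarrow> bool" where
  "csubspace V \<longleftrightarrow> 0 \<in> V \<and> (\<forall>x\<in>V. \<forall>y\<in>V. x + y \<in> V) \<and> (\<forall>c. \<forall>x\<in>V. c *\<^sub>C x \<in> V)"

lemma csubspace_imp_subspace: "csubspace V \<Longrightarrow> subspace V"
  by (metis csubspace_def scaleC_of_real subspace_def)

definition bounded_clinear :: "('a::complex_inner \<Rightarrow> 'b::complex_inner) \<Rightarrow> bool" where
  "bounded_clinear T \<longleftrightarrow> bounded_linear T \<and> (\<forall>c x. T (c *\<^sub>C x) = c *\<^sub>C T x)"

lemma bounded_clinear_scaleC: "bounded_clinear T \<Longrightarrow> T (c *\<^sub>C x) = c *\<^sub>C T x"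
  by (simp add: bounded_clinear_def)

lemma bounded_clinearI:
  assumes "\<And>x y. T (x + y) = T x + T y" "\<And>c x. T (c *\<^sub>C x) = c *\<^sub>C T x"
    "\<And>x. norm (T x) \<le> K * norm x"
  shows "bounded_clinear T"
  unfolding bounded_clinear_def
proof (intro conjI allI assms bounded_linear_intro)
  show "T (r *\<^sub>R x) = r *\<^sub>R T x" for r x
    using assms(2)[of "complex_of_real r" x] by (simp add: scaleC_of_real)
  show "norm (T x) \<le> norm x * K" for x using assms(3)[of x] by (simp add: mult.commute)
qed

lemma bounded_clinear_ident: "bounded_clinear (\<lambda>x. x)"
  and bounded_clinear_compose: "bounded_clinear S \<Longrightarrow> bounded_clinear T \<Longrightarrow> bounded_clinear (\<lambda>x. S (T x))"
  and bounded_clinear_add: "bounded_clinear f \<Longrightarrow> bounded_clinear g \<Longrightarrow> bounded_clinear (\<lambda>x. f x + g x)"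
  and bounded_clinear_diff: "bounded_clinear f \<Longrightarrow> bounded_clinear g \<Longrightarrow> bounded_clinear (\<lambda>x. f x - g x)"
  by (auto simp: bounded_clinear_def scaleC_add_right scaleC_diff_right
      intro: bounded_linear_compose bounded_linear_add bounded_linear_sub)

lemma bounded_ops_UNIV_iff: "T \<in> bounded_ops UNIV UNIV \<longleftrightarrow> bounded_clinear T"
proof
  assume "T \<in> bounded_ops UNIV UNIV"
  then show "bounded_clinear T" by (auto simp: bounded_ops_def intro: bounded_clinearI)
next
  assume "bounded_clinear T"
  then interpret T: bounded_linear T by (simp add: bounded_clinear_def)
  show "T \<in> bounded_ops UNIV UNIV"
    using \<open>bounded_clinear T\<close> T.bounded
    by (auto simp: bounded_ops_def bounded_clinear_def T.add mult.commute)
qed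

section \<open>The closed range theorem\<close>

text \<open>Solving \<open>A\<^sup>* y = z\<close> means representing the functional \<open>A x \<mapsto> \<langle>x, z\<rangle>\<close> on the range of \<open>A\<close>.
  It is well defined because \<open>z\<close> is orthogonal to the kernel, and it is bounded because
  preimages can be chosen boundedly.\<close>

theorem Range_op_adjoint_eq_orthogonal_ker:
  fixes A :: "('a::chilbert_space \<times> 'b::chilbert_space) set"
  assumes A: "linear_operator A" "closed A" "closed (Range A)"
  shows "Range (op_adjoint A) = {z. \<forall>x\<in>op_ker A. inner x z = 0}"
proof (intro equalityI subsetI)
  fix z assume "z \<in> Range (op_adjoint A)"
  then obtain y where y: "\<And>x w. (x, w) \<in> A \<Longrightarrow> cinner w y = cinner x z" by (auto simp: op_adjoint_def)
  have "inner x z = 0" if "(x, 0) \<in> A" for x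
    using arg_cong[OF y[OF that], of Re] by (simp add: Re_cinner)
  then show "z \<in> {z. \<forall>x\<in>op_ker A. inner x z = 0}" by (auto simp: op_ker_def)
next
  fix z assume "z \<in> {z. \<forall>x\<in>op_ker A. inner x z = 0}"
  then have z: "\<And>x. (x, 0) \<in> A \<Longrightarrow> inner x z = 0" by (simp add: op_ker_def)
  have add: "(x + x', w + w') \<in> A" if "(x, w) \<in> A" "(x', w') \<in> A" for x x' w w'
    using A(1) that by (auto simp: linear_operator_def)
  have scaleC: "(c *\<^sub>C x, c *\<^sub>C w) \<in> A" if "(x, w) \<in> A" for c x w
    using A(1) that by (auto simp: linear_operator_def)
  have "subspace A"
    unfolding subspace_def using A(1) add scaleC
    by (auto simp: linear_operator_def zero_prod_def simp flip: scaleC_of_real)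
  have "subspace (Range A)"
    unfolding subspace_def
    using subspace_0[OF \<open>subspace A\<close>] add scaleC by (fastforce simp: zero_prod_def simp flip: scaleC_of_real)
  obtain C where C: "\<And>w. w \<in> Range A \<Longrightarrow> \<exists>x. (x, w) \<in> A \<and> norm x \<le> C * norm w"
    using closed_operator_bounded_preimages[OF \<open>subspace A\<close> A(2,3)] by blast
  have wd: "inner x z = inner x' z" if "(x, w) \<in> A" "(x', w) \<in> A" for x x' w
    using z[of "x - x'"] subspace_diff[OF \<open>subspace A\<close> that] by (simp add: inner_diff_left)
  have bd: "\<bar>inner x z\<bar> \<le> C * norm w * norm z" if xw: "(x, w) \<in> A" for x w
  proof -
    obtain x' where x': "(x', w) \<in> A" "norm x' \<le> C * norm w" using C xw by blast
    have "\<bar>inner x' z\<bar> \<le> norm x' * norm z" by (rule Cauchy_Schwarz_ineq2)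
    also have "\<dots> \<le> C * norm w * norm z" using x'(2) by (intro mult_right_mono) auto
    finally show ?thesis using wd[OF xw x'(1)] by simp
  qed
  \<comment> \<open>The functional is extended to the whole space by the orthogonal projection onto the range.\<close>
  have "\<exists>p\<in>Range A. \<forall>v\<in>Range A. inner (w - p) v = 0" for w
    using orthogonal_decomposition_exists[OF \<open>subspace (Range A)\<close> A(3), of w] by metis
  then have "\<exists>x p. (x, p) \<in> A \<and> (\<forall>v\<in>Range A. inner (w - p) v = 0)" for w by blast
  then obtain X p where Xp: "\<And>w. (X w, p w) \<in> A" "\<And>w v. v \<in> Range A \<Longrightarrow> inner (w - p w) v = 0"
    by metis
  have p_eq: "p w = v" if "v \<in> Range A" "\<And>u. u \<in> Range A \<Longrightarrow> inner (w - v) u = 0" for w v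
  proof -
    have "p w - v \<in> Range A" using Xp(1) that(1) \<open>subspace (Range A)\<close> by (blast intro: subspace_diff)
    then have "inner (w - v) (p w - v) = 0" "inner (w - p w) (p w - v) = 0"
      using that(2) Xp(2) by auto
    then have "inner (p w - v) (p w - v) = 0" by (simp add: inner_diff_left)
    then show ?thesis by simp
  qed
  have "bounded_linear (\<lambda>w. inner (X w) z)"
  proof (rule bounded_linear_intro)
    show "inner (X (w + w')) z = inner (X w) z + inner (X w') z" for w w'
    proof -
      have sum: "(X w + X w', p w + p w') \<in> A" using add Xp(1) by blast
      have "inner (w + w' - (p w + p w')) u = 0" if "u \<in> Range A" for u
        using Xp(2)[OF that, of w] Xp(2)[OF that, of w'] by (simp add: inner_diff_left inner_add_left)
      then have "p (w + w') = p w + p w'" using sum by (intro p_eq) blast+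
      then show ?thesis using wd[OF Xp(1)[of "w + w'"]] sum by (simp add: inner_add_left)
    qed
    show "inner (X (r *\<^sub>R w)) z = r *\<^sub>R inner (X w) z" for r w
    proof -
      have s: "(r *\<^sub>R X w, r *\<^sub>R p w) \<in> A" using scaleC[OF Xp(1), of r] by (simp add: scaleC_of_real)
      then have "p (r *\<^sub>R w) = r *\<^sub>R p w"
        using Xp(2) by (intro p_eq) (blast, simp flip: scaleR_diff_right)
      then show ?thesis using wd[OF Xp(1)[of "r *\<^sub>R w"]] s by simp
    qed
    show "norm (inner (X w) z) \<le> norm w * (\<bar>C\<bar> * norm z)" for w
    proof -
      have "inner (w - p w) (p w) = 0" using Xp by blast
      then have "(norm w)\<^sup>2 = (norm (p w))\<^sup>2 + (norm (w - p w))\<^sup>2"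
        by (simp add: power2_norm_eq_inner inner_diff_left inner_diff_right inner_commute)
      then have "norm (p w) \<le> norm w" by (metis le_add_same_cancel1 norm_ge_zero power2_le_imp_le zero_le_power2)
      have "\<bar>inner (X w) z\<bar> \<le> C * norm (p w) * norm z" by (rule bd[OF Xp(1)])
      also have "\<dots> \<le> \<bar>C\<bar> * norm w * norm z"
        using \<open>norm (p w) \<le> norm w\<close> by (intro mult_right_mono mult_mono) auto
      finally show ?thesis by (simp add: mult_ac)
    qed
  qed
  then obtain y where y: "\<And>w. inner (X w) z = inner w y" using Riesz_representation by blast
  have inner: "inner w y = inner x z" if "(x, w) \<in> A" for x w
  proof -
    have "p w = w" using that by (intro p_eq) auto
    then show ?thesis using wd[OF that, of "X w"] Xp(1)[of w] y[of w] by simp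
  qed
  have "cinner w y = cinner x z" if "(x, w) \<in> A" for x w
    using inner[OF that] inner[OF scaleC[OF that, of \<i>]] by (simp add: cinner_eq_Complex_inner)
  then show "z \<in> Range (op_adjoint A)" by (auto simp: op_adjoint_def)
qed

section \<open>Partial inverses of operators with respect to an orthogonal projection\<close>

text \<open>The two summands of the space enter only through the projection \<open>P\<close> onto the first one:
  \<open>P x = x\<close> and \<open>P x = 0\<close> express membership. As \<open>1 - P\<close> is again an orthogonal projection, every
  result is available with the summands interchanged.\<close>

locale orthogonal_projection =
  fixes P :: "'a::chilbert_space \<Rightarrow> 'a"
  assumes clin: "bounded_clinear P"
    and idem [simp]: "P (P x) = P x"
    and selfadjoint: "inner (P x) y = inner x (P y)"
begin

abbreviation Q :: "'a \<Rightarrow> 'a" where "Q x \<equiv> x - P x"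

sublocale P: bounded_linear P
  using clin by (simp add: bounded_clinear_def)

lemma clin_Q: "bounded_clinear Q"
  by (rule bounded_clinear_diff[OF bounded_clinear_ident clin])

lemma complementary: "orthogonal_projection Q"
  using clin_Q by unfold_locales (auto simp: P.diff inner_diff_left inner_diff_right selfadjoint)

lemma orthogonal: "P x = x \<Longrightarrow> P y = 0 \<Longrightarrow> inner x y = 0"
  by (metis selfadjoint inner_zero_right)

lemma inner_P_left: "P y = y \<Longrightarrow> inner (P x) y = inner x y"
  by (simp add: selfadjoint)

lemma inner_Q_left: "P y = 0 \<Longrightarrow> inner (Q x) y = inner x y"
  by (simp add: selfadjoint inner_diff_left)

lemma norm_P_Q: "(norm x)\<^sup>2 = (norm (P x))\<^sup>2 + (norm (Q x))\<^sup>2"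
proof -
  have "inner (P x) (Q x) = 0" by (rule orthogonal) (simp_all add: P.diff)
  then show ?thesis
    by (simp add: power2_norm_eq_inner inner_diff_left inner_diff_right inner_commute)
qed

lemma norm_P_le: "norm (P x) \<le> norm x"
  using norm_P_Q[of x] by - (rule power2_le_imp_le, simp_all)

lemma norm_Q_le: "norm (Q x) \<le> norm x"
  using norm_P_Q[of x] by - (rule power2_le_imp_le, simp_all)

definition coercive_on_range :: "real \<Rightarrow> ('a \<Rightarrow> 'a) \<Rightarrow> bool" where
  "coercive_on_range c a \<longleftrightarrow> c > 0 \<and> (\<forall>x. P x = x \<longrightarrow> c * (norm x)\<^sup>2 \<le> inner (a x) x)"

text \<open>The first half of the exchange of components: \<open>P x\<close> is replaced by the \<open>P\<close>-component of \<open>a x\<close>.\<close>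

definition exchange :: "('a \<Rightarrow> 'a) \<Rightarrow> 'a \<Rightarrow> 'a" where
  "exchange a x = P (a x) + Q x"

lemma P_exchange [simp]: "P (exchange a x) = P (a x)"
  by (simp add: exchange_def P.add P.diff)

lemma bounded_clinear_exchange:
  assumes "bounded_clinear a"
  shows "bounded_clinear (exchange a)"
  unfolding exchange_def[abs_def]
  by (rule bounded_clinear_add[OF bounded_clinear_compose[OF clin assms] clin_Q])

text \<open>In block form \<open>exchange a\<close> is triangular with diagonal \<open>a\<^sub>0\<^sub>0\<close> and \<open>1\<close>, so it is as
  invertible as \<open>a\<^sub>0\<^sub>0\<close>. The Lax-Milgram theorem is applied to the block diagonal part, which
  is coercive on the whole space.\<close>

lemma exchange_invertible:
  assumes a: "bounded_clinear a" and c: "coercive_on_range c a"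
  shows "bij (exchange a)" and "bounded_clinear (inv (exchange a))"
proof -
  interpret a: bounded_linear a using a by (simp add: bounded_clinear_def)
  have c0: "c > 0" and coer: "\<And>x. c * (norm (P x))\<^sup>2 \<le> inner (a (P x)) (P x)"
    using c by (auto simp: coercive_on_range_def)
  interpret ex: bounded_linear "exchange a"
    using bounded_clinear_exchange[OF a] by (simp add: bounded_clinear_def)
  define E where "E x = P (a (P x)) + Q x" for x
  have "bounded_clinear E"
    unfolding E_def[abs_def]
    by (rule bounded_clinear_add[OF bounded_clinear_compose[OF clin bounded_clinear_compose[OF a clin]] clin_Q])
  then interpret E: bounded_linear E by (simp add: bounded_clinear_def)
  have "bij E"
  proof (rule coercive_imp_bij)
    show "min c 1 * (norm x)\<^sup>2 \<le> inner (E x) x" for x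
    proof -
      have "min c 1 * (norm x)\<^sup>2 = min c 1 * (norm (P x))\<^sup>2 + min c 1 * (norm (Q x))\<^sup>2"
        by (simp add: norm_P_Q[of x] distrib_left)
      also have "\<dots> \<le> c * (norm (P x))\<^sup>2 + 1 * (norm (Q x))\<^sup>2"
        by (intro add_mono mult_right_mono) auto
      also have "\<dots> \<le> inner (a (P x)) (P x) + inner (Q x) (Q x)"
        using coer[of x] by (simp add: power2_norm_eq_inner)
      also have "\<dots> = inner (E x) x"
        by (simp add: E_def inner_add_left inner_diff_left inner_diff_right selfadjoint)
      finally show ?thesis .
    qed
  qed (use c0 E.bounded_linear_axioms in auto)
  have eq: "exchange a x = E x + P (a (Q x))" for x
    by (simp add: exchange_def E_def P.diff a.diff)
  have QE: "P (E x) = P (a (P x))" for x by (simp add: E_def P.add P.diff)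
  show bij: "bij (exchange a)"
  proof (rule bijI)
    show "inj (exchange a)"
    proof (rule injI)
      fix x y assume xy: "exchange a x = exchange a y"
      then have z: "exchange a (x - y) = 0" by (simp add: ex.diff)
      then have "P (a (x - y)) = 0" using P_exchange[of a "x - y"] by (simp add: P.zero)
      then have "Q (x - y) = 0" using z by (simp add: exchange_def)
      then have "E (x - y) = 0" using z eq[of "x - y"] by (simp add: a.zero P.zero)
      then show "x = y" using \<open>bij E\<close> by (metis E.diff bij_def injD right_minus_eq)
    qed
    show "surj (exchange a)"
          unfolding surj_def
    proof
      fix y
      obtain x where x: "E x = y - P (a (Q y))" using \<open>bij E\<close> by (metis bij_pointE)
      have "P (a (P x)) = P y - P (a (Q y))" using QE[of x] x by (simp add: P.diff)
      then have "P y + Q x = y" using x by (simp add: E_def)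
      then have "Q x = Q y" by (metis add_diff_cancel_left')
      then show "\<exists>x. y = exchange a x" using eq[of x] x by (metis diff_add_cancel)
    qed
  qed
  have surj: "exchange a (inv (exchange a) y) = y" for y
    using bij by (simp add: bij_is_surj surj_f_inv_f)
  have inj: "x = y" if "exchange a x = exchange a y" for x y
    using bij that by (meson bij_is_inj injD)
  obtain M where M: "M > 0" "\<And>x. norm (a x) \<le> norm x * M" using a.pos_bounded by blast
  show "bounded_clinear (inv (exchange a))"
  proof (rule bounded_clinearI)
    show "inv (exchange a) (x + y) = inv (exchange a) x + inv (exchange a) y" for x y
      by (rule inj) (simp add: surj ex.add)
    show "inv (exchange a) (d *\<^sub>C x) = d *\<^sub>C inv (exchange a) x" for d x
      by (rule inj) (simp add: surj bounded_clinear_scaleC[OF bounded_clinear_exchange[OF a]])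
    show "norm (inv (exchange a) y) \<le> ((1 + M) / c + 1) * norm y" for y
    proof -
      define x where "x = inv (exchange a) y"
      have y: "y = P (a x) + Q x" using surj[of y] by (simp add: x_def exchange_def)
      then have Q: "Q x = Q y" and Pa: "P (a x) = P y" by (simp_all add: P.add P.diff)
      have "norm (P x) \<le> (1 + M) / c * norm y"
      proof (cases "P x = 0")
        case False
        have "a (P x) = a x - a (Q y)" unfolding Q[symmetric] by (simp flip: a.diff)
        then have "c * (norm (P x))\<^sup>2 \<le> inner (a x - a (Q y)) (P x)" using coer[of x] by simp
        also have "\<dots> = inner (P y - a (Q y)) (P x)"
          by (simp add: inner_diff_left flip: Pa) (simp add: selfadjoint)
        also have "\<dots> \<le> norm (P y - a (Q y)) * norm (P x)" by (rule norm_cauchy_schwarz)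
        also have "\<dots> \<le> ((1 + M) * norm y) * norm (P x)"
        proof (rule mult_right_mono)
          have "norm (a (Q y)) \<le> norm y * M"
            using M(2)[of "Q y"] mult_right_mono[OF norm_Q_le[of y], of M] M(1) by linarith
          then show "norm (P y - a (Q y)) \<le> (1 + M) * norm y"
            using norm_triangle_ineq4[of "P y" "a (Q y)"] norm_P_le[of y] by (simp add: algebra_simps)
        qed simp
        finally have "c * norm (P x) \<le> (1 + M) * norm y"
          using False by (simp add: power2_eq_square)
        then show ?thesis using c0 by (simp add: field_simps)
      qed (use M(1) c0 in simp)
      moreover have "norm x \<le> norm (P x) + norm (Q x)"
        using norm_triangle_ineq[of "P x" "Q x"] by simp
      ultimately show ?thesis using norm_Q_le[of y] Q unfolding x_def by (simp add: distrib_right)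
    qed
  qed
qed

text \<open>If \<open>a x = y\<close>, the partial inverse of \<open>a\<close> exchanges the \<open>P\<close>-components of \<open>x\<close> and \<open>y\<close>: it
  sends \<open>P y + Q x\<close> to \<open>P x + Q y\<close>. Solving the block equations for \<open>P x\<close> shows that its blocks are
  \<open>a\<^sub>0\<^sub>0\<^sup>-\<^sup>1\<close>, \<open>- a\<^sub>0\<^sub>0\<^sup>-\<^sup>1 a\<^sub>0\<^sub>1\<close>, \<open>a\<^sub>1\<^sub>0 a\<^sub>0\<^sub>0\<^sup>-\<^sup>1\<close> and the Schur complement \<open>a\<^sub>1\<^sub>1 - a\<^sub>1\<^sub>0 a\<^sub>0\<^sub>0\<^sup>-\<^sup>1 a\<^sub>0\<^sub>1\<close>. It
  is also known as the principal pivot transform.\<close>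

definition partial_inverse :: "('a \<Rightarrow> 'a) \<Rightarrow> 'a \<Rightarrow> 'a" where
  "partial_inverse a u = (let x = inv (exchange a) u in P x + Q (a x))"

lemma partial_inverse_exchange:
  assumes "bounded_clinear a" "coercive_on_range c a"
  shows "partial_inverse a (P (a x) + Q x) = P x + Q (a x)"
proof -
  have "inv (exchange a) (exchange a x) = x"
    using bij_is_inj[OF exchange_invertible(1)[OF assms]] by simp
  then show ?thesis by (simp add: partial_inverse_def exchange_def)
qed

text \<open>Compared with \<open>partial_inverse_exchange\<close>, the operator and its partial inverse have changed
  places. This symmetry makes the transformation an involution.\<close>

lemma partial_inverse_graph:
  assumes "bounded_clinear a" "coercive_on_range c a"
  shows "a (P (partial_inverse a u) + Q u) = P u + Q (partial_inverse a u)"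
proof -
  obtain x where "exchange a x = u"
    using bij_pointE[OF exchange_invertible(1)[OF assms]] by metis
  then have x: "u = P (a x) + Q x" by (simp add: exchange_def)
  show ?thesis unfolding x partial_inverse_exchange[OF assms] by (simp add: P.add P.diff)
qed

lemma partial_inverse_eqI:
  assumes "bounded_clinear a" "coercive_on_range c a"
    and "\<And>u. a (P (T u) + Q u) = P u + Q (T u)"
  shows "partial_inverse a = T"
proof
  fix u
  show "partial_inverse a u = T u"
    using partial_inverse_exchange[OF assms(1,2), of "P (T u) + Q u"]
    by (simp add: assms(3) P.add P.diff)
qed

lemma bounded_clinear_partial_inverse:
  assumes "bounded_clinear a" "coercive_on_range c a"
  shows "bounded_clinear (partial_inverse a)"
proof -
  note inv = exchange_invertible(2)[OF assms]
  show ?thesis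
  unfolding partial_inverse_def[abs_def] Let_def
  by (rule bounded_clinear_add[OF bounded_clinear_compose[OF clin inv]
        bounded_clinear_compose[OF clin_Q bounded_clinear_compose[OF assms(1) inv]]])
qed

lemma partial_inverse_partial_inverse:
  assumes "bounded_clinear a" "coercive_on_range c a" "coercive_on_range d (partial_inverse a)"
  shows "partial_inverse (partial_inverse a) = a"
  by (rule partial_inverse_eqI[where T = a, OF bounded_clinear_partial_inverse[OF assms(1,2)] assms(3)
        partial_inverse_exchange[OF assms(1,2)]])

section \<open>Blocks in terms of the partial inverse\<close>

lemma bop_adjoint_embed:
  assumes V: "V = {x. P x = x}"
  shows "bop_adjoint V UNIV (embed V) = P"
  unfolding bop_adjoint_def
proof (rule the_equality)
  have P_inner: "cinner x y = cinner x (P y)" if "P x = x" for x y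
    using that selfadjoint[of x y] selfadjoint[of "\<i> *\<^sub>C x" y]
    by (simp add: cinner_eq_Complex_inner bounded_clinear_scaleC[OF clin])
  show P: "P \<in> bounded_ops UNIV V \<and> (\<forall>x\<in>V. \<forall>y\<in>UNIV. cinner (embed V x) y = cinner x (P y))"
  proof
    show "P \<in> bounded_ops UNIV V"
      using clin bounded_ops_UNIV_iff[of P] by (auto simp: bounded_ops_def V)
    show "\<forall>x\<in>V. \<forall>y\<in>UNIV. cinner (embed V x) y = cinner x (P y)"
    proof (intro ballI)
      fix x y assume "x \<in> V"
      then show "cinner (embed V x) y = cinner x (P y)" using P_inner[of x y] by (simp add: V embed_def)
    qed
  qed
  fix S assume S: "S \<in> bounded_ops UNIV V \<and> (\<forall>x\<in>V. \<forall>y\<in>UNIV. cinner (embed V x) y = cinner x (S y))"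
  show "S = P"
  proof
    fix y
    have Sy: "P (S y) = S y" using S by (auto simp: bounded_ops_def V)
    define x where "x = S y - P y"
    have x: "P x = x" by (simp add: x_def P.diff Sy)
    then have "x \<in> V" "embed V x = x" by (simp_all add: V embed_def)
    then have "cinner x y = cinner x (S y)" using S by (metis UNIV_I)
    then have "inner x y = inner x (S y)" by (metis Re_cinner)
    moreover have "inner x y = inner x (P y)" using x by (metis selfadjoint)
    ultimately have "inner x (S y) = inner x (P y)" by simp
    then have "inner x x = 0" by (simp add: x_def inner_diff_right)
    then show "S y = P y" by (simp add: x_def)
  qed
qed

lemma block_eq:
  assumes "V = {x. P x = x}"
  shows "block V U a = (\<lambda>x\<in>U. P (a x))"
  using bop_adjoint_embed[OF assms] by (auto simp: block_def compose_def embed_def fun_eq_iff)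

end

lemma bop_inv_eqI:
  assumes "inj_on T U" "\<And>v. v \<in> V \<Longrightarrow> S v \<in> U \<and> T (S v) = v"
  shows "bop_inv U V T = restrict S V"
proof
  fix v
  show "bop_inv U V T v = restrict S V v"
    using assms inv_into_f_f[OF assms(1), of "S v"] by (cases "v \<in> V") (auto simp: bop_inv_def)
qed

lemma bop_norm_le_iff:
  assumes T: "\<exists>K. \<forall>x\<in>U. norm (T x) \<le> K * norm x" and U: "0 \<in> U" and b: "b \<ge> 0"
  shows "bop_norm U T \<le> b \<longleftrightarrow> (\<forall>x\<in>U. norm (T x) \<le> b * norm x)"
proof -
  obtain K where K: "\<And>x. x \<in> U \<Longrightarrow> norm (T x) \<le> K * norm x" using T by blast
  have "norm (T x) / norm x \<le> \<bar>K\<bar>" if "x \<in> U" for x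
  proof (cases "x = 0")
    case False
    then have "norm (T x) / norm x \<le> K" using K[OF that] by (simp add: divide_le_eq)
    then show ?thesis by simp
  qed simp
  then have bdd: "bdd_above ((\<lambda>x. norm (T x) / norm x) ` U)" by (rule bdd_aboveI2)
  have T0: "T 0 = 0" using K[OF U] by simp
  have "norm (T x) / norm x \<le> b \<longleftrightarrow> norm (T x) \<le> b * norm x" for x
    using b T0 by (cases "x = 0") (auto simp: divide_le_eq)
  then show ?thesis
    unfolding bop_norm_def using U by (subst cSUP_le_iff[OF _ bdd]) auto
qed

context orthogonal_projection
begin

context
  fixes R0 R1 :: "'a set"
  assumes R0: "R0 = {x. P x = x}" and R1: "R1 = {x. P x = 0}"
begin

lemma R0_iff: "x \<in> R0 \<longleftrightarrow> P x = x" and R1_iff: "x \<in> R1 \<longleftrightarrow> P x = 0"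
  by (auto simp: R0 R1)

lemma R1_eq: "R1 = {x. Q x = x}"
  by (auto simp: R1)

lemmas block_R0 = block_eq[OF R0]
lemmas block_R1 = orthogonal_projection.block_eq[OF complementary R1_eq]

context
  fixes a c
  assumes a: "bounded_clinear a" and c: "coercive_on_range c a"
begin

lemma partial_inverse_R0:
  assumes "P u = u"
  shows "a (P (partial_inverse a u)) = u + Q (partial_inverse a u)" "P (a (P (partial_inverse a u))) = u"
  using partial_inverse_graph[OF a c, of u] assms by (simp_all add: P.add P.diff)

lemma partial_inverse_R1:
  assumes "P u = 0"
  shows "a (P (partial_inverse a u) + u) = Q (partial_inverse a u)"
  using partial_inverse_graph[OF a c, of u] assms by simp

lemma injective_on_range:
  assumes "P x = x" "P (a x) = 0"
  shows "x = 0"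
proof -
  have "inner (a x) x = 0" using orthogonal[OF assms] by (simp add: inner_commute)
  then have "c * (norm x)\<^sup>2 \<le> 0" using c assms(1) by (auto simp: coercive_on_range_def)
  then show ?thesis using c by (simp add: coercive_on_range_def mult_le_0_iff)
qed

lemma inj_on_block_R0_R0: "inj_on (block R0 R0 a) R0"
proof (rule inj_onI)
  interpret a: bounded_linear a using a by (simp add: bounded_clinear_def)
  fix x y assume "x \<in> R0" "y \<in> R0" "block R0 R0 a x = block R0 R0 a y"
  then show "x = y" using injective_on_range[of "x - y"] by (simp add: R0_iff block_R0 a.diff P.diff)
qed

lemma inv_block_R0_R0: "bop_inv R0 R0 (block R0 R0 a) = (\<lambda>u\<in>R0. P (partial_inverse a u))"
  by (rule bop_inv_eqI[OF inj_on_block_R0_R0]) (simp add: R0_iff block_R0 partial_inverse_R0(2))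

lemma block_R1_R0_inv: "compose R0 (block R1 R0 a) (bop_inv R0 R0 (block R0 R0 a)) = (\<lambda>u\<in>R0. Q (partial_inverse a u))"
  unfolding inv_block_R0_R0
  by (auto simp: block_R1 compose_def fun_eq_iff R0_iff partial_inverse_R0(1)
      P.add P.diff)

text \<open>Since \<open>a (P (T u) + u)\<close> has no \<open>P\<close>-component, \<open>- P (T u)\<close> solves the equation \<open>a\<^sub>0\<^sub>0 x = P (a u)\<close>;
  and so does \<open>P (T (P (a u)))\<close>, where \<open>T\<close> is the partial inverse.\<close>

lemma partial_inverse_P_a:
  assumes u: "P u = 0"
  shows "P (partial_inverse a (P (a u))) = - P (partial_inverse a u)"
proof -
  interpret a: bounded_linear a using a by (simp add: bounded_clinear_def)
  interpret T: bounded_linear "partial_inverse a"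
    using bounded_clinear_partial_inverse[OF a c] by (simp add: bounded_clinear_def)
  have "P (a (P (partial_inverse a u))) + P (a u) = 0"
    using arg_cong[OF partial_inverse_R1[OF u], of P] by (simp add: P.add P.diff a.add)
  moreover have "P (a (P (partial_inverse a (P (a u))))) = P (a u)" by (rule partial_inverse_R0) simp
  ultimately have "P (a (P (partial_inverse a (P (a u))) + P (partial_inverse a u))) = 0" by (simp add: P.add a.add add.commute)
  then have "P (partial_inverse a (P (a u))) + P (partial_inverse a u) = 0" by (rule injective_on_range[rotated]) (simp_all add: P.add)
  then show ?thesis by (simp only: eq_neg_iff_add_eq_0)
qed

lemma inv_block_R0_R1:
  "compose R1 (bop_inv R0 R0 (block R0 R0 a)) (block R0 R1 a) = (\<lambda>u\<in>R1. - P (partial_inverse a u))"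
  unfolding inv_block_R0_R0
  by (auto simp: block_R0 compose_def fun_eq_iff R0_iff R1_iff partial_inverse_P_a)

lemma Schur_complement:
  "(\<lambda>x\<in>R1. block R1 R1 a x - block R1 R0 a (bop_inv R0 R0 (block R0 R0 a) (block R0 R1 a x)))
    = (\<lambda>u\<in>R1. Q (partial_inverse a u))"
proof -
  interpret a: bounded_linear a using a by (simp add: bounded_clinear_def)
  have "Q (a u) - Q (a (P (partial_inverse a (P (a u))))) = Q (partial_inverse a u)" if u: "P u = 0" for u
  proof -
    have "Q (a u) - Q (a (P (partial_inverse a (P (a u))))) = Q (a (P (partial_inverse a u) + u))"
      unfolding partial_inverse_P_a[OF u] by (simp add: a.add a.neg P.add P.neg algebra_simps)
    also have "\<dots> = Q (partial_inverse a u)" by (simp add: partial_inverse_R1[OF u] P.diff)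
    finally show ?thesis .
  qed
  then show ?thesis
    unfolding inv_block_R0_R0 by (auto simp: block_R0 block_R1 fun_eq_iff R0_iff R1_iff)
qed

text \<open>The Schur complement inverts the block \<open>(a\<^sup>-\<^sup>1)\<^sub>1\<^sub>1\<close>, because \<open>a\<close> maps \<open>P (T u) + u\<close> to \<open>Q (T u)\<close> if
  \<open>T\<close> is its partial inverse and \<open>P u = 0\<close>.\<close>

lemma inv_block_R1_R1_inv:
  assumes "bij a"
  shows "bop_inv R1 R1 (block R1 R1 (inv a)) = (\<lambda>u\<in>R1. Q (partial_inverse a u))"
proof (rule bop_inv_eqI)
  interpret a: bounded_linear a using a by (simp add: bounded_clinear_def)
  have inv_a: "inv a (a x) = x" "a (inv a x) = x" for x
    using assms by (simp_all add: bij_is_inj bij_is_surj surj_f_inv_f)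
  show "inj_on (block R1 R1 (inv a)) R1"
  proof (rule inj_onI)
    fix x y assume xy: "x \<in> R1" "y \<in> R1" "block R1 R1 (inv a) x = block R1 R1 (inv a) y"
    define z where "z = inv a x - inv a y"
    have "a z = x - y" by (simp add: z_def a.diff inv_a)
    moreover have "Q z = 0" using xy by (simp add: z_def block_R1 P.diff) (simp add: algebra_simps)
    then have "P z = z" by simp
    moreover have "P (x - y) = 0" using xy(1,2) by (simp add: R1_iff P.diff)
    ultimately have "z = 0" by (metis injective_on_range)
    then have "x - y = 0" using \<open>a z = x - y\<close> a.zero by metis
    then show "x = y" by simp
  qed
  fix u assume "u \<in> R1"
  then have "inv a (Q (partial_inverse a u)) = P (partial_inverse a u) + u"
    using partial_inverse_R1[of u] inv_a(1) by (metis R1_iff)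
  then show "Q (partial_inverse a u) \<in> R1 \<and> block R1 R1 (inv a) (Q (partial_inverse a u)) = u"
    using \<open>u \<in> R1\<close> by (simp add: R1_iff block_R1 P.add P.diff)
qed

end

end

end

section \<open>Bounded sets of operators in the weak operator topology\<close>

lemma eq_if_inner_eq: "(\<And>y. inner u y = inner v y) \<Longrightarrow> u = (v :: 'a::real_inner)"
  using inner_eq_zero_iff[of "u - v"] by (simp add: inner_diff_left)

lemma inner_operator_perturbation:
  fixes T :: "'a::real_inner \<Rightarrow> 'a"
  assumes "bounded_linear T" "\<And>x. norm (T x) \<le> C * norm x"
  shows "\<bar>inner (T x') y' - inner (T x) y\<bar> \<le> C * norm (x' - x) * norm y' + C * norm x * norm (y' - y)"
proof -
  interpret T: bounded_linear T by fact
  have "inner (T x') y' - inner (T x) y = inner (T (x' - x)) y' + inner (T x) (y' - y)"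
    by (simp add: T.diff inner_diff_left inner_diff_right)
  also have "\<bar>\<dots>\<bar> \<le> norm (T (x' - x)) * norm y' + norm (T x) * norm (y' - y)"
    by (intro order_trans[OF abs_triangle_ineq] add_mono Cauchy_Schwarz_ineq2)
  also have "\<dots> \<le> C * norm (x' - x) * norm y' + C * norm x * norm (y' - y)"
    by (intro add_mono mult_right_mono assms(2)) auto
  finally show ?thesis .
qed

text \<open>On a bounded set of operators the forms \<open>\<langle>T x, y\<rangle>\<close> are uniform limits of those with \<open>x\<close> and
  \<open>y\<close> in a dense set.\<close>

lemma dense_approximation:
  fixes D :: "'a::real_inner set"
  assumes "closure D = UNIV"
  obtains x' y' :: "nat \<Rightarrow> 'a" and e where "\<And>n. x' n \<in> D" "\<And>n. y' n \<in> D" "e \<longlonglongrightarrow> (0 :: real)"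
    "\<And>n T. bounded_linear T \<Longrightarrow> (\<And>z. norm (T z) \<le> C * norm z) \<Longrightarrow>
       \<bar>inner (T (x' n)) (y' n) - inner (T x) (y :: 'a)\<bar> \<le> e n"
proof -
  have "x \<in> closure D" "y \<in> closure D" using assms by auto
  then obtain x' y' where xy: "\<And>n::nat. x' n \<in> D" "x' \<longlonglongrightarrow> x" "\<And>n::nat. y' n \<in> D" "y' \<longlonglongrightarrow> y"
    unfolding closure_sequential by metis
  let ?e = "\<lambda>n. C * norm (x' n - x) * norm (y' n) + C * norm x * norm (y' n - y)"
  have "?e \<longlonglongrightarrow> C * norm (x - x) * norm y + C * norm x * norm (y - y)"
    by (intro tendsto_intros xy)
  then have "?e \<longlonglongrightarrow> 0" by simp
  then show thesis using that[of x' y' ?e] xy(1,3) inner_operator_perturbation by blast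
qed

text \<open>Boundedness carries the convergence of the coefficients from the dense set to all vectors; the
  limit is a bounded bilinear form and hence comes from an operator.\<close>

lemma weak_limit_exists:
  fixes T :: "nat \<Rightarrow> 'a::{real_inner, complete_space} \<Rightarrow> 'a" and D :: "'a set"
  assumes lin: "\<And>n. bounded_linear (T n)" and C: "\<And>n x. norm (T n x) \<le> C * norm x"
    and D: "closure D = UNIV"
    and conv: "\<And>x y. x \<in> D \<Longrightarrow> y \<in> D \<Longrightarrow> convergent (\<lambda>n. inner (T n x) y)"
  obtains S where "bounded_linear S" "\<And>x y. (\<lambda>n. inner (T n x) y) \<longlonglongrightarrow> inner (S x) y"
proof -
  have "Cauchy (\<lambda>n. inner (T n x) y)" for x y
  proof (rule metric_CauchyI)
    fix r :: real assume r: "r > 0"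
    obtain x' y' e where D': "\<And>n. x' n \<in> D" "\<And>n. y' n \<in> D" and e: "e \<longlonglongrightarrow> (0 :: real)"
      and approx: "\<And>n S. bounded_linear S \<Longrightarrow> (\<And>z. norm (S z) \<le> C * norm z) \<Longrightarrow>
       \<bar>inner (S (x' n)) (y' n) - inner (S x) y\<bar> \<le> e n"
      using dense_approximation[OF D, of C x y] by metis
    have "eventually (\<lambda>n. e n < r / 3) sequentially"
      using r by (intro order_tendstoD(2)[OF e]) auto
    then obtain k where k: "e k < r / 3" by (auto simp: eventually_sequentially)
    have near: "\<bar>inner (T n (x' k)) (y' k) - inner (T n x) y\<bar> < r / 3" for n
      using approx[OF lin C, of n k] k by simp
    have "Cauchy (\<lambda>n. inner (T n (x' k)) (y' k))" by (intro convergent_Cauchy conv D')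
    from metric_CauchyD[OF this, of "r / 3"] r obtain N where
      N: "\<And>m n. m \<ge> N \<Longrightarrow> n \<ge> N \<Longrightarrow> \<bar>inner (T m (x' k)) (y' k) - inner (T n (x' k)) (y' k)\<bar> < r / 3"
      by (auto simp: dist_real_def)
    have "\<bar>inner (T m x) y - inner (T n x) y\<bar> < r" if "m \<ge> N" "n \<ge> N" for m n
      using near[of m] near[of n] N[OF that] by argo
    then show "\<exists>M. \<forall>m\<ge>M. \<forall>n\<ge>M. dist (inner (T m x) y) (inner (T n x) y) < r"
      unfolding dist_real_def by blast
  qed
  then have "\<exists>l. (\<lambda>n. inner (T n x) y) \<longlonglongrightarrow> l" for x y
    using Cauchy_convergent convergent_def by blast
  then obtain b where b: "\<And>x y. (\<lambda>n. inner (T n x) y) \<longlonglongrightarrow> b x y" by metis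
  have bI: "b x y = l" if "(\<lambda>n. inner (T n x) y) \<longlonglongrightarrow> l" for x y l
    using LIMSEQ_unique[OF b that] .
  have "bounded_bilinear b"
  proof
    fix x x' y y' :: 'a and r :: real
    have eqs: "T n (x + x') = T n x + T n x'" "T n (r *\<^sub>R x) = r *\<^sub>R T n x" for n
      using lin[of n] by (simp_all add: linear_add linear_scale bounded_linear.linear)
    show "b (x + x') y = b x y + b x' y"
      by (rule bI) (simp add: eqs inner_add_left tendsto_add b)
    show "b x (y + y') = b x y + b x y'"
      by (rule bI) (simp add: inner_add_right tendsto_add b)
    show "b (r *\<^sub>R x) y = r *\<^sub>R b x y"
      by (rule bI) (simp add: eqs tendsto_mult_left b)
    show "b x (r *\<^sub>R y) = r *\<^sub>R b x y"
      by (rule bI) (simp add: tendsto_mult_left b)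
    show "\<exists>K. \<forall>x y. norm (b x y) \<le> norm x * norm y * K"
    proof (intro exI[of _ C] allI)
      fix x y
      have "\<bar>inner (T n x) y\<bar> \<le> norm x * norm y * C" for n
        using Cauchy_Schwarz_ineq2[of "T n x" y] mult_right_mono[OF C[of n x], of "norm y"]
        by (simp add: mult_ac)
      then show "norm (b x y) \<le> norm x * norm y * C"
        using tendsto_rabs[OF b] by (intro Lim_bounded[of "\<lambda>n. \<bar>inner (T n x) y\<bar>" _ 0]) auto
    qed
  qed
  then obtain S where "bounded_linear S" "\<And>x y. b x y = inner (S x) y"
    using bounded_bilinear_form_representation by blast
  then show thesis using that b by simp
qed

text \<open>Weak lower semicontinuity of the norm, in the form in which bounds pass to weak limits: as
  \<open>\<parallel>x n - l\<parallel>\<^sup>2 \<ge> 0\<close>, the square norm of \<open>x n\<close> dominates \<open>2 \<langle>x n, l\<rangle> - \<parallel>l\<parallel>\<^sup>2\<close>, which is weakly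
  continuous in \<open>x n\<close>.\<close>

lemma weak_limit_norm_le:
  fixes x :: "nat \<Rightarrow> 'a::real_inner"
  assumes weak: "\<And>y. (\<lambda>n. inner (x n) y) \<longlonglongrightarrow> inner l y"
    and c: "c \<ge> 0" "\<And>n. c * (norm (x n))\<^sup>2 \<le> s n" and s: "s \<longlonglongrightarrow> t"
  shows "c * (norm l)\<^sup>2 \<le> t"
proof -
  have "c * (2 * inner (x n) l - (norm l)\<^sup>2) \<le> s n" for n
  proof -
    have "0 \<le> (norm (x n - l))\<^sup>2" by simp
    then have "2 * inner (x n) l - (norm l)\<^sup>2 \<le> (norm (x n))\<^sup>2"
      by (simp add: power2_norm_eq_inner inner_diff_left inner_diff_right inner_commute)
    then show ?thesis using mult_left_mono[OF _ c(1)] c(2) order_trans by blast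
  qed
  moreover have "(\<lambda>n. c * (2 * inner (x n) l - (norm l)\<^sup>2)) \<longlonglongrightarrow> c * (2 * inner l l - (norm l)\<^sup>2)"
    by (intro tendsto_intros weak)
  ultimately have "c * (2 * inner l l - (norm l)\<^sup>2) \<le> t"
    using LIMSEQ_le[OF _ s] by blast
  then show ?thesis by (simp add: power2_norm_eq_inner)
qed

text \<open>The matrix coefficients with respect to a countable dense set embed a bounded, weakly
  sequentially closed set of operators into a countable product of intervals, as a compact set. The
  remaining coefficients are uniform limits of these and therefore continuous on the image.\<close>

lemma weak_coordinates:
  fixes \<T> :: "('a::{real_inner, complete_space} \<Rightarrow> 'a) set" and D :: "'a set"
  assumes lin: "\<And>T. T \<in> \<T> \<Longrightarrow> bounded_linear T"
    and C: "\<And>T x. T \<in> \<T> \<Longrightarrow> norm (T x) \<le> C * norm x"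
    and weakly_closed: "\<And>T S. range T \<subseteq> \<T> \<Longrightarrow> bounded_linear S \<Longrightarrow>
        (\<And>x y. (\<lambda>n::nat. inner (T n x) y) \<longlonglongrightarrow> inner (S x) y) \<Longrightarrow> S \<in> \<T>"
    and D: "countable D" "closure D = UNIV"
  obtains \<Phi> :: "('a \<Rightarrow> 'a) \<Rightarrow> nat \<times> nat \<Rightarrow> real"
  where "inj_on \<Phi> \<T>" "compact (\<Phi> ` \<T>)" "\<And>k. \<exists>x y. \<forall>T. \<Phi> T k = inner (T x) y"
    "\<And>x y. continuous_on (\<Phi> ` \<T>) (\<lambda>v. inner (inv_into \<T> \<Phi> v x) y)"
proof -
  have "D \<noteq> {}" using D(2) by auto
  then obtain d :: "nat \<Rightarrow> 'a" where d: "D = range d" using D(1) uncountable_def by metis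
  define \<Phi> where "\<Phi> T k = inner (T (d (fst k))) (d (snd k))" for T :: "'a \<Rightarrow> 'a" and k
  have approx: "\<exists>k e. e \<longlonglongrightarrow> 0 \<and> (\<forall>n::nat. \<forall>T\<in>\<T>. \<bar>\<Phi> T (k n) - inner (T x) y\<bar> \<le> e n)" for x y
  proof -
    obtain x' y' e where "\<And>n. x' n \<in> D" "\<And>n. y' n \<in> D" and e: "e \<longlonglongrightarrow> (0 :: real)"
      and *: "\<And>n S. bounded_linear S \<Longrightarrow> (\<And>z. norm (S z) \<le> C * norm z) \<Longrightarrow>
       \<bar>inner (S (x' n)) (y' n) - inner (S x) y\<bar> \<le> e n"
      using dense_approximation[OF D(2), of C x y] by metis
    then have "\<exists>i j. x' n = d i \<and> y' n = d j" for n unfolding d by fast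
    then obtain i j where "\<And>n. x' n = d (i n)" "\<And>n. y' n = d (j n)" by metis
    then have "\<bar>\<Phi> T (i n, j n) - inner (T x) y\<bar> \<le> e n" if "T \<in> \<T>" for n T
      using *[OF lin[OF that] C[OF that], of n] by (simp add: \<Phi>_def)
    then show ?thesis using e by (intro exI[of _ "\<lambda>n. (i n, j n)"] exI[of _ e]) simp
  qed
  have inj: "inj_on \<Phi> \<T>"
  proof (rule inj_onI)
    fix S T assume ST: "S \<in> \<T>" "T \<in> \<T>" "\<Phi> S = \<Phi> T"
    have "inner (S x) y = inner (T x) y" for x y
    proof -
      obtain k e where e: "e \<longlonglongrightarrow> 0" and k: "\<And>n::nat. \<And>T. T \<in> \<T> \<Longrightarrow> \<bar>\<Phi> T (k n) - inner (T x) y\<bar> \<le> e n"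
        using approx[of x y] by blast
      have lim: "(\<lambda>n. \<Phi> T (k n)) \<longlonglongrightarrow> inner (T x) y" if "T \<in> \<T>" for T
        using k[OF that] by (intro LIM_zero_cancel[OF Lim_null_comparison[OF _ e]]) simp
      show ?thesis using LIMSEQ_unique[OF lim[OF ST(1)]] lim[OF ST(2)] ST(3) by simp
    qed
    then have "S x = T x" for x by (rule eq_if_inner_eq)
    then show "S = T" by (rule ext)
  qed
  have cont: "continuous_on (\<Phi> ` \<T>) (\<lambda>v. inner (inv_into \<T> \<Phi> v x) y)" for x y
  proof -
    obtain k e where e: "e \<longlonglongrightarrow> 0" and k: "\<And>n::nat. \<And>T. T \<in> \<T> \<Longrightarrow> \<bar>\<Phi> T (k n) - inner (T x) y\<bar> \<le> e n"
      using approx[of x y] by blast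
    have "uniform_limit (\<Phi> ` \<T>) (\<lambda>n v. v (k n)) (\<lambda>v. inner (inv_into \<T> \<Phi> v x) y) sequentially"
    proof (rule uniform_limitI)
      fix r :: real assume "r > 0"
      then have "eventually (\<lambda>n. e n < r) sequentially" by (rule order_tendstoD(2)[OF e])
      then show "\<forall>\<^sub>F n in sequentially. \<forall>v\<in>\<Phi> ` \<T>. dist (v (k n)) (inner (inv_into \<T> \<Phi> v x) y) < r"
      proof (rule eventually_mono, intro ballI)
        fix n v assume n: "e n < r" and "v \<in> \<Phi> ` \<T>"
        then obtain T where T: "T \<in> \<T>" "v = \<Phi> T" by blast
        then show "dist (v (k n)) (inner (inv_into \<T> \<Phi> v x) y) < r"
          using k[OF T(1), of n] n inj by (simp add: dist_real_def)
      qed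
    qed
    then show ?thesis
      by (rule uniform_limit_theorem[OF always_eventually[OF allI] _ sequentially_bot,
            OF continuous_on_subset[OF continuous_on_product_coordinates subset_UNIV]])
  qed
  define B where "B k = C * norm (d (fst k)) * norm (d (snd k))" for k
  have "compact (\<Pi>\<^sub>E k\<in>UNIV. {- B k..B k})"
    using compactin_PiE[of "\<lambda>_. euclidean" UNIV "\<lambda>k. {- B k..B k}"]
    by (simp add: euclidean_product_topology)
  moreover have bd: "- B k \<le> \<Phi> T k \<and> \<Phi> T k \<le> B k" if T: "T \<in> \<T>" for T k
  proof -
    have "\<bar>\<Phi> T k\<bar> \<le> norm (T (d (fst k))) * norm (d (snd k))"
      unfolding \<Phi>_def by (rule Cauchy_Schwarz_ineq2)
    also have "\<dots> \<le> B k" unfolding B_def by (intro mult_right_mono C[OF T]) simp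
    finally show ?thesis by (simp add: abs_le_iff)
  qed
  then have sub: "\<Phi> ` \<T> \<subseteq> (\<Pi>\<^sub>E k\<in>UNIV. {- B k..B k})" by auto
  ultimately have seq: "seq_compact (\<Pi>\<^sub>E k\<in>UNIV. {- B k..B k})"
    using compact_eq_seq_compact_metric by blast
  have "seq_compact (\<Phi> ` \<T>)"
    unfolding seq_compact_def
  proof (intro allI impI)
    fix f :: "nat \<Rightarrow> nat \<times> nat \<Rightarrow> real" assume f: "\<forall>n. f n \<in> \<Phi> ` \<T>"
    then have "\<forall>n. f n \<in> (\<Pi>\<^sub>E k\<in>UNIV. {- B k..B k})" using sub by blast
    then obtain v r where r: "strict_mono r" "(f \<circ> r) \<longlonglongrightarrow> v"
      using seq unfolding seq_compact_def by blast
    have lim: "(\<lambda>n. f (r n) k) \<longlonglongrightarrow> v k" for k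
      using r(2) continuous_on_tendsto_compose[OF continuous_on_product_coordinates[of k], of "f \<circ> r" v]
      by (simp add: comp_def)
    have "\<forall>n. \<exists>T. T \<in> \<T> \<and> f n = \<Phi> T" using f by blast
    then obtain T where T: "\<And>n. T n \<in> \<T>" "\<And>n. f n = \<Phi> (T n)" by metis
    have conv: "convergent (\<lambda>n. inner (T (r n) x) y)" if xy: "x \<in> D" "y \<in> D" for x y
    proof -
      obtain i j where ij: "x = d i" "y = d j" using xy unfolding d image_iff by blast
      have "(\<lambda>n. inner (T (r n) x) y) \<longlonglongrightarrow> v (i, j)"
        using lim[of "(i, j)"] unfolding T(2) \<Phi>_def ij by simp
      then show ?thesis by (rule convergentI)
    qed
    then obtain S where S: "bounded_linear S" "\<And>x y. (\<lambda>n. inner (T (r n) x) y) \<longlonglongrightarrow> inner (S x) y"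
      using weak_limit_exists[of "\<lambda>n. T (r n)" C D, OF lin[OF T(1)] C[OF T(1)] D(2) conv] by blast
    have "S \<in> \<T>" using weakly_closed[OF _ S] T(1) by blast
    moreover have "v = \<Phi> S"
    proof
      fix k
      have "(\<lambda>n. \<Phi> (T (r n)) k) \<longlonglongrightarrow> \<Phi> S k" unfolding \<Phi>_def by (rule S(2))
      then show "v k = \<Phi> S k" using LIMSEQ_unique lim[of k] by (simp add: T(2))
    qed
    ultimately show "\<exists>l\<in>\<Phi> ` \<T>. \<exists>r. strict_mono r \<and> (f \<circ> r) \<longlonglongrightarrow> l" using r by blast
  qed
  then have "compact (\<Phi> ` \<T>)" using compact_eq_seq_compact_metric by blast
  moreover have "\<exists>x y. \<forall>T. \<Phi> T k = inner (T x) y" for k unfolding \<Phi>_def by blast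
  ultimately show thesis using that inj cont by blast
qed

section \<open>Initial topologies\<close>

lemma topspace_initial_topology [simp]: "topspace (initial_topology S F) = S"
  unfolding initial_topology_def topology_generated_by_topspace by auto

lemma continuous_map_initial_topology:
  assumes "(f, Y) \<in> F" "f \<in> S \<rightarrow> topspace Y"
  shows "continuous_map (initial_topology S F) Y f"
  unfolding continuous_map
proof (intro conjI allI impI)
  fix W assume "openin Y W"
  then show "openin (initial_topology S F) {x \<in> topspace (initial_topology S F). f x \<in> W}"
    unfolding topspace_initial_topology using assms(1)
    unfolding initial_topology_def by (intro topology_generated_by_Basis) blast
qed (use assms(2) in auto)

lemma continuous_map_into_initial_topology:
  assumes "g \<in> topspace Z \<rightarrow> S" "\<And>f Y. (f, Y) \<in> F \<Longrightarrow> continuous_map Z Y (\<lambda>z. f (g z))"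
  shows "continuous_map Z (initial_topology S F) g"
  unfolding initial_topology_def
proof (rule continuous_on_generated_topo)
  fix U assume "U \<in> insert S {{a \<in> S. f a \<in> W} |f Y W. (f, Y) \<in> F \<and> openin Y W}"
  then consider "U = S" | f Y W where "U = {a \<in> S. f a \<in> W}" "(f, Y) \<in> F" "openin Y W" by blast
  then show "openin Z (g -` U \<inter> topspace Z)"
  proof cases
    case 1
    then have "g -` U \<inter> topspace Z = topspace Z" using assms(1) by auto
    then show ?thesis by simp
  next
    case 2
    then have "g -` U \<inter> topspace Z = {z \<in> topspace Z. f (g z) \<in> W}" using assms(1) by auto
    then show ?thesis using openin_continuous_map_preimage[OF assms(2)[OF 2(2)] 2(3)] by simp
  qed
qed (use assms(1) in auto)

lemma topspace_weak_op_topology [simp]: "topspace (weak_op_topology U V) = bounded_ops U V"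
  by (simp add: weak_op_topology_def)

lemma continuous_map_weak_op_coefficient:
  assumes "x \<in> U" "y \<in> V"
  shows "continuous_map (weak_op_topology U V) euclidean (\<lambda>T. cinner (T x) y)"
  unfolding weak_op_topology_def using assms by (intro continuous_map_initial_topology) auto

lemma continuous_map_into_weak_op_topology:
  assumes "g \<in> topspace Z \<rightarrow> bounded_ops U V"
    and "\<And>x y. x \<in> U \<Longrightarrow> y \<in> V \<Longrightarrow> continuous_map Z euclidean (\<lambda>z. cinner (g z x) y)"
  shows "continuous_map Z (weak_op_topology U V) g"
  unfolding weak_op_topology_def using assms by (intro continuous_map_into_initial_topology) auto

lemma metrizable_seq_compact_if_homeomorphic_compact:
  fixes K :: "'b::metric_space set"
  assumes hom: "homeomorphic_maps X (top_of_set K) f g" and K: "compact K"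
  shows "metrizable_space X" "seq_compact_space X"
proof -
  have "X homeomorphic_space top_of_set K" using hom homeomorphic_space_def by blast
  then show "metrizable_space X"
    using homeomorphic_metrizable_space metrizable_space_euclidean metrizable_space_subtopology by blast
  show "seq_compact_space X"
    unfolding seq_compact_space_def
  proof (intro allI impI)
    fix x :: "nat \<Rightarrow> 'a" assume x: "\<forall>n. x n \<in> topspace X"
    have gf: "g (f z) = z" if "z \<in> topspace X" for z using hom that by (auto simp: homeomorphic_maps_def)
    have "f (x n) \<in> K" for n
      using hom x by (auto simp: homeomorphic_maps_def continuous_map_def)
    then obtain l r where l: "l \<in> K" "strict_mono r" "((\<lambda>n. f (x n)) \<circ> r) \<longlonglongrightarrow> l"
      using K unfolding compact_eq_seq_compact_metric seq_compact_def by metis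
    then have "limitin (top_of_set K) (\<lambda>n. f (x (r n))) l sequentially"
      using \<open>\<And>n. f (x n) \<in> K\<close> by (simp add: limitin_subtopology comp_def)
    moreover have g: "continuous_map (top_of_set K) X g" using hom by (simp add: homeomorphic_maps_def)
    ultimately have "limitin X (g \<circ> (\<lambda>n. f (x (r n)))) (g l) sequentially"
      by (rule continuous_map_limit[rotated])
    moreover have "g \<circ> (\<lambda>n. f (x (r n))) = x \<circ> r" using gf x by auto
    moreover have "g l \<in> topspace X" using g l(1) by (auto simp: continuous_map_def)
    ultimately show "\<exists>l r. l \<in> topspace X \<and> strict_mono r \<and> limitin X (x \<circ> r) l sequentially"
      using l(2) by metis
  qed
qed

section \<open>The class of partial inverses\<close>

lemma csubspace_orthogonal_projection:
  fixes V :: "'a::chilbert_space set"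
  assumes V: "csubspace V" "closed V"
  obtains P where "orthogonal_projection P" "V = {x. P x = x}"
    "{z. \<forall>x\<in>V. inner x z = 0} = {x. P x = 0}"
proof -
  note sub = csubspace_imp_subspace[OF V(1)]
  have scaleC: "c *\<^sub>C x \<in> V" if "x \<in> V" for c x using V(1) that by (simp add: csubspace_def)
  have "\<exists>v\<in>V. \<forall>w\<in>V. inner (x - v) w = 0" for x
    using orthogonal_decomposition_exists[OF sub V(2), of x] by metis
  then obtain P where P: "\<And>x. P x \<in> V" "\<And>x w. w \<in> V \<Longrightarrow> inner (x - P x) w = 0" by metis
  have eqI: "P x = v" if "v \<in> V" "\<And>w. w \<in> V \<Longrightarrow> inner (x - v) w = 0" for x v
  proof -
    have "P x - v \<in> V" using P(1) that(1) by (rule subspace_diff[OF sub])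
    then have "inner (x - v) (P x - v) = 0" "inner (x - P x) (P x - v) = 0"
      using P(2) that(2) by auto
    then have "inner (P x - v) (P x - v) = 0" by (simp add: inner_diff_left)
    then show ?thesis by simp
  qed
  have fix_iff: "P x = x \<longleftrightarrow> x \<in> V" for x using P(1)[of x] eqI[of x x] by auto
  have "inner x (P y) = inner (P x) (P y)" for x y
    using P(2)[OF P(1)[of y], of x] by (simp add: inner_diff_left)
  then have self: "inner (P x) y = inner x (P y)" for x y by (metis inner_commute)
  have "orthogonal_projection P"
  proof
    show "bounded_clinear P"
    proof (rule bounded_clinearI)
      fix x y c
      show "P (x + y) = P x + P y"
      proof (rule eqI)
        show "inner (x + y - (P x + P y)) w = 0" if "w \<in> V" for w
          using P(2)[OF that, of x] P(2)[OF that, of y] by (simp add: inner_diff_left inner_add_left)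
      qed (intro subspace_add[OF sub] P)
      show "P (c *\<^sub>C x) = c *\<^sub>C P x"
      proof (rule eqI)
        show "inner (c *\<^sub>C x - c *\<^sub>C P x) w = 0" if "w \<in> V" for w
          using P(2)[OF scaleC[OF that]] by (simp add: inner_scaleC_left flip: scaleC_diff_right)
      qed (intro scaleC P)
      have "(norm (P x))\<^sup>2 = inner x (P x)"
        using P(2)[OF P(1), of x x] by (simp add: power2_norm_eq_inner inner_diff_left)
      also have "\<dots> \<le> norm x * norm (P x)" by (rule norm_cauchy_schwarz)
      finally show "norm (P x) \<le> 1 * norm x"
        by (cases "P x = 0") (simp_all add: power2_eq_square)
    qed
  qed (use fix_iff P(1) self in auto)
  moreover have "(\<forall>x\<in>V. inner x z = 0) \<longleftrightarrow> P z = 0" for z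
  proof
    assume "\<forall>x\<in>V. inner x z = 0"
    then show "P z = 0" using subspace_0[OF sub] by (intro eqI) (simp_all add: inner_commute)
  next
    assume "P z = 0"
    then show "\<forall>x\<in>V. inner x z = 0" using P(2)[of _ z] by (simp add: inner_commute)
  qed
  then have "{z. \<forall>x\<in>V. inner x z = 0} = {x. P x = 0}" by simp
  moreover have "V = {x. P x = x}" using fix_iff by simp
  ultimately show thesis using that by blast
qed

context orthogonal_projection
begin

text \<open>The image of \<open>M1_class\<close> under the partial inverse. For each vector \<open>u\<close> a quantity that is weakly
  lower semicontinuous in \<open>T\<close> is bounded by one that is weakly continuous.\<close>

definition partial_inverse_class :: "real \<Rightarrow> real \<Rightarrow> ('a \<Rightarrow> 'a) set" where
  "partial_inverse_class \<alpha> \<beta> = {T. bounded_clinear T \<and>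
     (\<forall>u. P u = u \<longrightarrow> \<alpha> * (norm (P (T u)))\<^sup>2 \<le> inner (T u) u \<and>
        1 / \<beta> * (norm u)\<^sup>2 \<le> inner (T u) u \<and> norm (Q (T u)) \<le> \<beta> * norm u) \<and>
     (\<forall>u. P u = 0 \<longrightarrow> \<alpha> * (norm u)\<^sup>2 \<le> inner (T u) u \<and>
        1 / \<beta> * (norm (Q (T u)))\<^sup>2 \<le> inner (T u) u \<and> norm (P (T u)) \<le> \<beta> * norm u)}"

text \<open>The constant collects the bounds \<open>1 / \<alpha>\<close>, \<open>\<beta>\<close>, \<open>\<beta>\<close> and \<open>\<beta>\<close> of the four blocks.\<close>

lemma partial_inverse_class_norm_le:
  assumes T: "T \<in> partial_inverse_class \<alpha> \<beta>" and pos: "\<alpha> > 0" "\<beta> > 0"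
  shows "norm (T x) \<le> (1 / \<alpha> + 3 * \<beta>) * norm x"
proof -
  interpret T: bounded_linear T using T by (simp add: partial_inverse_class_def bounded_clinear_def)
  have PP: "norm (P (T u)) \<le> 1 / \<alpha> * norm u" if "P u = u" for u
  proof (cases "P (T u) = 0")
    case False
    have "\<alpha> * (norm (P (T u)))\<^sup>2 \<le> inner (P (T u)) u"
      using T that by (simp add: partial_inverse_class_def inner_P_left)
    also have "\<dots> \<le> norm (P (T u)) * norm u" by (rule norm_cauchy_schwarz)
    finally have "\<alpha> * norm (P (T u)) \<le> norm u" using False by (simp add: power2_eq_square)
    then show ?thesis using pos by (simp add: field_simps)
  qed (use pos in simp)
  have QQ: "norm (Q (T u)) \<le> \<beta> * norm u" if "P u = 0" for u
  proof (cases "Q (T u) = 0")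
    case False
    have "1 / \<beta> * (norm (Q (T u)))\<^sup>2 \<le> inner (Q (T u)) u"
      using T that inner_Q_left[OF that] by (simp add: partial_inverse_class_def)
    also have "\<dots> \<le> norm (Q (T u)) * norm u" by (rule norm_cauchy_schwarz)
    finally have "norm (Q (T u)) * (1 / \<beta> * norm (Q (T u))) \<le> norm (Q (T u)) * norm u"
      by (simp add: power2_eq_square mult_ac)
    moreover have "0 < norm (Q (T u))" using False by simp
    ultimately have "1 / \<beta> * norm (Q (T u)) \<le> norm u" by (rule mult_left_le_imp_le)
    then show ?thesis using pos by (simp add: field_simps)
  qed (use pos in simp)
  have "T x = P (T (P x)) + Q (T (P x)) + P (T (Q x)) + Q (T (Q x))"
    using T.add[of "P x" "Q x"] by simp
  then have "norm (T x) \<le> norm (P (T (P x))) + norm (Q (T (P x))) + norm (P (T (Q x))) + norm (Q (T (Q x)))"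
    by (simp only:) (intro norm_triangle_mono order_refl)
  also have "\<dots> \<le> 1 / \<alpha> * norm x + \<beta> * norm x + \<beta> * norm x + \<beta> * norm x"
  proof (intro add_mono)
    have "norm (P (T (P x))) \<le> 1 / \<alpha> * norm (P x)" by (rule PP) simp
    also have "\<dots> \<le> 1 / \<alpha> * norm x" using pos by (intro mult_left_mono norm_P_le) simp
    finally show "norm (P (T (P x))) \<le> 1 / \<alpha> * norm x" .
    have "norm (Q (T (P x))) \<le> \<beta> * norm (P x)" using T by (simp add: partial_inverse_class_def)
    also have "\<dots> \<le> \<beta> * norm x" using pos by (intro mult_left_mono norm_P_le) simp
    finally show "norm (Q (T (P x))) \<le> \<beta> * norm x" .
    have "norm (P (T (Q x))) \<le> \<beta> * norm (Q x)" using T by (simp add: partial_inverse_class_def P.diff)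
    also have "\<dots> \<le> \<beta> * norm x" using pos by (intro mult_left_mono norm_Q_le) simp
    finally show "norm (P (T (Q x))) \<le> \<beta> * norm x" .
    have "norm (Q (T (Q x))) \<le> \<beta> * norm (Q x)" by (rule QQ) (simp add: P.diff)
    also have "\<dots> \<le> \<beta> * norm x" using pos by (intro mult_left_mono norm_Q_le) simp
    finally show "norm (Q (T (Q x))) \<le> \<beta> * norm x" .
  qed
  also have "\<dots> = (1 / \<alpha> + 3 * \<beta>) * norm x" by (simp add: algebra_simps)
  finally show ?thesis .
qed

lemma partial_inverse_class_weakly_closed:
  assumes pos: "\<alpha> > 0" "\<beta> > 0" and T: "\<And>n::nat. T n \<in> partial_inverse_class \<alpha> \<beta>"
    and S: "bounded_linear S" and lim: "\<And>x y. (\<lambda>n. inner (T n x) y) \<longlonglongrightarrow> inner (S x) y"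
  shows "S \<in> partial_inverse_class \<alpha> \<beta>"
proof -
  have limP: "(\<lambda>n. inner (P (T n x)) y) \<longlonglongrightarrow> inner (P (S x)) y" for x y
    unfolding selfadjoint by (rule lim)
  have limQ: "(\<lambda>n. inner (Q (T n x)) y) \<longlonglongrightarrow> inner (Q (S x)) y" for x y
    unfolding inner_diff_left by (intro tendsto_diff lim limP)
  have scaleC: "S (c *\<^sub>C x) = c *\<^sub>C S x" for c x
  proof (rule eq_if_inner_eq)
    fix y
    have "T n (c *\<^sub>C x) = c *\<^sub>C T n x" for n
      using T[of n] by (simp add: partial_inverse_class_def bounded_clinear_def)
    then have "(\<lambda>n. inner (T n (c *\<^sub>C x)) y) = (\<lambda>n. inner (T n x) (cnj c *\<^sub>C y))"
      by (simp add: inner_scaleC_left)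
    then show "inner (S (c *\<^sub>C x)) y = inner (c *\<^sub>C S x) y"
      using LIMSEQ_unique[OF lim[of "c *\<^sub>C x" y]] lim[of x "cnj c *\<^sub>C y"]
      by (simp add: inner_scaleC_left)
  qed
  have norm_le: "norm l \<le> b"
    if weak: "\<And>y. (\<lambda>n. inner (x n) y) \<longlonglongrightarrow> inner l y" and b: "\<And>n. norm (x n) \<le> b" for x b and l :: 'a
  proof -
    have b0: "0 \<le> b" using b[of 0] norm_ge_zero order_trans by blast
    have "1 * (norm (x n))\<^sup>2 \<le> b\<^sup>2" for n using power_mono[OF b, of n 2] by simp
    then have "1 * (norm l)\<^sup>2 \<le> b\<^sup>2"
      by (rule weak_limit_norm_le[OF weak zero_le_one _ tendsto_const])
    then have "(norm l)\<^sup>2 \<le> b\<^sup>2" by simp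
    then show ?thesis using b0 by (rule power2_le_imp_le)
  qed
  have inner_ge: "c \<le> inner (S u) u" if "\<And>n. c \<le> inner (T n u) u" for c u
    using LIMSEQ_le_const[OF lim] that by blast
  show ?thesis
    unfolding partial_inverse_class_def
  proof (intro CollectI conjI allI impI)
    show "bounded_clinear S" using S scaleC by (simp add: bounded_clinear_def)
    fix u
    show "\<alpha> * (norm (P (S u)))\<^sup>2 \<le> inner (S u) u" if "P u = u"
      by (rule weak_limit_norm_le[OF limP _ _ lim])
        (use T pos that in \<open>auto simp: partial_inverse_class_def\<close>)
    show "1 / \<beta> * (norm u)\<^sup>2 \<le> inner (S u) u" if "P u = u"
      by (rule inner_ge) (use T that in \<open>auto simp: partial_inverse_class_def\<close>)
    show "norm (Q (S u)) \<le> \<beta> * norm u" if "P u = u"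
      by (rule norm_le[OF limQ]) (use T that in \<open>auto simp: partial_inverse_class_def\<close>)
    show "\<alpha> * (norm u)\<^sup>2 \<le> inner (S u) u" if "P u = 0"
      by (rule inner_ge) (use T that in \<open>auto simp: partial_inverse_class_def\<close>)
    show "1 / \<beta> * (norm (Q (S u)))\<^sup>2 \<le> inner (S u) u" if "P u = 0"
      by (rule weak_limit_norm_le[OF limQ _ _ lim])
        (use T pos that in \<open>auto simp: partial_inverse_class_def\<close>)
    show "norm (P (S u)) \<le> \<beta> * norm u" if "P u = 0"
      by (rule norm_le[OF limP]) (use T that in \<open>auto simp: partial_inverse_class_def\<close>)
  qed
qed

lemma partial_inverse_class_coercive:
  assumes "T \<in> partial_inverse_class \<alpha> \<beta>" "\<beta> > 0"
  shows "bounded_clinear T" "coercive_on_range (1 / \<beta>) T"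
  using assms by (auto simp: partial_inverse_class_def coercive_on_range_def)

text \<open>With \<open>a\<close> the partial inverse of \<open>T\<close> and \<open>u = P (a x)\<close> for \<open>P x = x\<close> one has \<open>P (T u) = x\<close>, so that
  the bound on \<open>P (T u)\<close> in the class is the coercivity of \<open>a\<^sub>0\<^sub>0\<close>.\<close>

lemma coercive_on_range_partial_inverse:
  assumes T: "T \<in> partial_inverse_class \<alpha> \<beta>" and pos: "\<alpha> > 0" "\<beta> > 0"
  shows "coercive_on_range \<alpha> (partial_inverse T)"
  unfolding coercive_on_range_def
proof (intro conjI allI impI)
  fix x assume x: "P x = x"
  define a where "a = partial_inverse T"
  define u where "u = P (a x)"
  have u: "P u = u" by (simp add: u_def)
  have Tu: "T u = x + Q (a x)"
    using partial_inverse_graph[OF partial_inverse_class_coercive[OF T pos(2)], of x] x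
    by (simp add: a_def u_def)
  then have PTu: "P (T u) = x" by (simp add: P.add P.diff x)
  have "\<alpha> * (norm x)\<^sup>2 \<le> inner (T u) u"
    using T u PTu unfolding partial_inverse_class_def by auto
  also have "\<dots> = inner x u" using PTu inner_P_left[OF u, of "T u"] by simp
  also have "\<dots> = inner (a x) x"
    using selfadjoint[of x "a x"] x by (simp add: u_def inner_commute)
  finally show "\<alpha> * (norm x)\<^sup>2 \<le> inner (partial_inverse T x) x" by (simp add: a_def)
qed (rule pos)

text \<open>The operator is the quotient of the two exchange maps of its partial inverse, for \<open>P\<close> and
  for the complementary projection, and both of them are invertible.\<close>

lemma invertible_if_partial_inverse_class:
  assumes a: "bounded_clinear a" "coercive_on_range c a"
    and T: "partial_inverse a \<in> partial_inverse_class \<alpha> \<beta>" and pos: "\<alpha> > 0" "\<beta> > 0"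
  shows "bij a" "bounded_clinear (inv a)"
proof -
  interpret compl: orthogonal_projection Q by (rule complementary)
  define T where "T = partial_inverse a"
  note Tc = partial_inverse_class_coercive[OF T[folded T_def] pos(2)]
  have coer: "compl.coercive_on_range \<alpha> T"
    using T pos(1) by (auto simp: compl.coercive_on_range_def partial_inverse_class_def T_def)
  note K = exchange_invertible[OF Tc]
  note L = compl.exchange_invertible[OF Tc(1) coer]
  have aK: "a (exchange T u) = compl.exchange T u" for u
    using partial_inverse_graph[OF a, of u] by (simp add: exchange_def compl.exchange_def T_def algebra_simps)
  have "a = compl.exchange T \<circ> inv (exchange T)"
  proof
    fix x
    show "a x = (compl.exchange T \<circ> inv (exchange T)) x"
      using aK[of "inv (exchange T) x"] K(1) by (simp add: bij_is_surj surj_f_inv_f)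
  qed
  then show bij: "bij a" using K(1) L(1) by (simp add: bij_comp bij_imp_bij_inv)
  have "inv a = (\<lambda>y. exchange T (inv (compl.exchange T) y))"
  proof
    fix y
    have "a (exchange T (inv (compl.exchange T) y)) = y"
      using L(1) by (simp add: aK bij_is_surj surj_f_inv_f)
    then show "inv a y = exchange T (inv (compl.exchange T) y)"
      using bij by (metis bij_inv_eq_iff)
  qed
  then show "bounded_clinear (inv a)"
    using bounded_clinear_compose[OF bounded_clinear_exchange[OF Tc(1)] L(2)] by simp
qed

lemma csubspace_fixed: "csubspace {x. P x = x}"
  by (auto simp: csubspace_def P.add P.zero bounded_clinear_scaleC[OF clin])

lemma csubspace_null: "csubspace {x. P x = 0}"
  by (auto simp: csubspace_def P.add P.zero bounded_clinear_scaleC[OF clin])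

end

lemma restrict_bounded_ops:
  assumes T: "bounded_clinear T" and U: "csubspace U" and V: "\<And>x. x \<in> U \<Longrightarrow> T x \<in> V"
  shows "(\<lambda>x\<in>U. T x) \<in> bounded_ops U V"
proof -
  interpret T: bounded_linear T using T by (simp add: bounded_clinear_def)
  obtain K where "\<And>x. norm (T x) \<le> norm x * K" using T.bounded by blast
  then show ?thesis
    using T U V unfolding bounded_ops_def csubspace_def bounded_clinear_def
    by (auto simp: T.add mult.commute intro!: exI[of _ K])
qed

text \<open>The four maps whose weak continuity defines \<^const>\<open>tau_H\<close>: the entries of the block
  factorisation of \<open>a\<close> into a lower triangular, a diagonal and an upper triangular factor, where the
  first diagonal entry \<open>a\<^sub>0\<^sub>0\<close> is replaced by its inverse.\<close>

definition schur00 :: "'a::complex_inner set \<Rightarrow> ('a \<Rightarrow> 'a) \<Rightarrow> 'a \<Rightarrow> 'a" where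
  "schur00 R0 a = bop_inv R0 R0 (block R0 R0 a)"

definition schur10 :: "'a::complex_inner set \<Rightarrow> 'a set \<Rightarrow> ('a \<Rightarrow> 'a) \<Rightarrow> 'a \<Rightarrow> 'a" where
  "schur10 R0 R1 a = compose R0 (block R1 R0 a) (bop_inv R0 R0 (block R0 R0 a))"

definition schur01 :: "'a::complex_inner set \<Rightarrow> 'a set \<Rightarrow> ('a \<Rightarrow> 'a) \<Rightarrow> 'a \<Rightarrow> 'a" where
  "schur01 R0 R1 a = compose R1 (bop_inv R0 R0 (block R0 R0 a)) (block R0 R1 a)"

definition schur11 :: "'a::complex_inner set \<Rightarrow> 'a set \<Rightarrow> ('a \<Rightarrow> 'a) \<Rightarrow> 'a \<Rightarrow> 'a" where
  "schur11 R0 R1 a = (\<lambda>x\<in>R1. block R1 R1 a x -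
     block R1 R0 a (bop_inv R0 R0 (block R0 R0 a) (block R0 R1 a x)))"

context orthogonal_projection
begin

context
  fixes A0 :: "('d::chilbert_space \<times> 'a) set" and A1 :: "('a \<times> 'c::chilbert_space) set"
    and R0 R1 :: "'a set" and \<alpha> \<beta> :: real
  assumes ran: "Range A0 = R0" "Range (op_adjoint A1) = R1"
    and R0: "R0 = {x. P x = x}" and R1: "R1 = {x. P x = 0}"
    and pos: "\<alpha> > 0" "\<beta> > 0"
begin

lemma M_class_imp:
  assumes "a \<in> M_class \<alpha> \<beta> A0 A1"
  shows "bounded_clinear a" "coercive_on_range \<alpha> a"
proof -
  show "bounded_clinear a" using assms by (simp add: M_class_def Let_def bounded_ops_UNIV_iff)
  have "\<alpha> * (norm x)\<^sup>2 \<le> inner (a x) x" if x: "P x = x" for x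
  proof -
    have "Re_ge R0 (block R0 R0 a) \<alpha>"
      using assms by (simp add: M_class_def Let_def ran)
    then show ?thesis
      using x by (simp add: Re_ge_def block_R0[OF R0 R1] Ball_def R0_iff[OF R0 R1] Re_cinner inner_P_left)
  qed
  then show "coercive_on_range \<alpha> a" using pos by (simp add: coercive_on_range_def)
qed

text \<open>Each condition on a block is rewritten by a substitution. If \<open>x = P (T u)\<close> with \<open>P u = u\<close>, then
  \<open>a\<^sub>0\<^sub>0 x = u\<close>, which gives the conditions on \<open>a\<^sub>0\<^sub>0\<close> and its inverse. If \<open>y = Q (T u)\<close> with \<open>P u = 0\<close>, then
  \<open>(a\<^sup>-\<^sup>1)\<^sub>1\<^sub>1 y = u\<close>, which gives those on \<open>(a\<^sup>-\<^sup>1)\<^sub>1\<^sub>1\<close> and its inverse.\<close>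

lemma M1_class_iff:
  "a \<in> M1_class \<alpha> \<beta> A0 A1 \<longleftrightarrow>
    bounded_clinear a \<and> coercive_on_range \<alpha> a \<and> partial_inverse a \<in> partial_inverse_class \<alpha> \<beta>"
proof (cases "bounded_clinear a \<and> coercive_on_range \<alpha> a")
  case False
  then show ?thesis using M_class_imp[of a] by (auto simp: M1_class_def Let_def)
next
  case True
  define T where "T = partial_inverse a"
  have a: "bounded_clinear a" and c: "coercive_on_range \<alpha> a" using True by auto
  have T: "bounded_clinear T" unfolding T_def by (rule bounded_clinear_partial_inverse[OF a c])
  note ctx = R0 R1 a c
  note mem = R0_iff[OF R0 R1] R1_iff[OF R0 R1]
  have c1: "Re_ge R0 (block R0 R0 a) \<alpha>"
    using c by (simp add: Re_ge_def block_R0[OF R0 R1] Ball_def mem Re_cinner inner_P_left coercive_on_range_def)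
  have c1': "\<alpha> * (norm (P (T u)))\<^sup>2 \<le> inner (T u) u" if u: "P u = u" for u
  proof -
    have "\<alpha> * (norm (P (T u)))\<^sup>2 \<le> inner (a (P (T u))) (P (T u))"
      using c by (simp add: coercive_on_range_def)
    also have "\<dots> = inner (P (a (P (T u)))) (T u)" by (simp add: selfadjoint)
    also have "\<dots> = inner (T u) u"
      using partial_inverse_R0(2)[OF ctx u] by (simp add: T_def inner_commute)
    finally show ?thesis .
  qed
  have c2: "Re_ge R0 (bop_inv R0 R0 (block R0 R0 a)) (1 / \<beta>)
      \<longleftrightarrow> (\<forall>u. P u = u \<longrightarrow> 1 / \<beta> * (norm u)\<^sup>2 \<le> inner (T u) u)"
    unfolding inv_block_R0_R0[OF ctx] by (simp add: Re_ge_def Ball_def mem Re_cinner inner_P_left T_def)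
  have c3: "Re_ge R1 (bop_inv R1 R1
        (block R1 R1 (inv a))) \<alpha>
      \<longleftrightarrow> (\<forall>u. P u = 0 \<longrightarrow> \<alpha> * (norm u)\<^sup>2 \<le> inner (T u) u)" if "bij a"
    unfolding inv_block_R1_R1_inv[OF ctx that]
    by (simp add: Re_ge_def Ball_def mem Re_cinner inner_Q_left T_def)
  have c4: "Re_ge R1 (block R1 R1 (inv a)) (1 / \<beta>)
      \<longleftrightarrow> (\<forall>u. P u = 0 \<longrightarrow> 1 / \<beta> * (norm (Q (T u)))\<^sup>2 \<le> inner (T u) u)" if "bij a"
  proof -
    have inv_a: "inv a (a x) = x" "a (inv a x) = x" for x
      using that by (simp_all add: bij_is_inj bij_is_surj surj_f_inv_f)
    have "Re_ge R1 (block R1 R1 (inv a)) (1 / \<beta>)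
      \<longleftrightarrow> (\<forall>y. P y = 0 \<longrightarrow> 1 / \<beta> * (norm y)\<^sup>2 \<le> inner (inv a y) y)"
      by (simp add: Re_ge_def block_R1[OF R0 R1] Ball_def mem Re_cinner inner_Q_left)
    also have "\<dots> \<longleftrightarrow> (\<forall>u. P u = 0 \<longrightarrow> 1 / \<beta> * (norm (Q (T u)))\<^sup>2 \<le> inner (T u) u)"
    proof (intro iffI allI impI)
      fix u assume *: "\<forall>y. P y = 0 \<longrightarrow> 1 / \<beta> * (norm y)\<^sup>2 \<le> inner (inv a y) y" and u: "P u = 0"
      have "inv a (Q (T u)) = P (T u) + u"
        using partial_inverse_R1[OF ctx u] inv_a(1) unfolding T_def by metis
      moreover have "P (Q (T u)) = 0" by (simp add: P.diff)
      ultimately have "1 / \<beta> * (norm (Q (T u)))\<^sup>2 \<le> inner (P (T u) + u) (Q (T u))"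
        using * by metis
      also have "\<dots> = inner (Q (T u)) u"
      proof -
        have "inner (P (T u)) (Q (T u)) = 0" by (rule orthogonal) (simp_all add: P.diff)
        then have "inner (P (T u) + u) (Q (T u)) = inner u (Q (T u))" unfolding inner_add_left by simp
        then show ?thesis by (simp only: inner_commute)
      qed
      finally show "1 / \<beta> * (norm (Q (T u)))\<^sup>2 \<le> inner (T u) u"
        by (simp only: inner_Q_left[OF u])
    next
      fix y assume *: "\<forall>u. P u = 0 \<longrightarrow> 1 / \<beta> * (norm (Q (T u)))\<^sup>2 \<le> inner (T u) u" and y: "P y = 0"
      define u where "u = Q (inv a y)"
      have u: "P u = 0" by (simp add: u_def P.diff)
      have Tu: "T u = P (inv a y) + y"
        using partial_inverse_exchange[OF a c, of "inv a y"] y by (simp add: u_def T_def inv_a)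
      then have "Q (T u) = y" using y by (simp add: P.add)
      moreover have "inner (T u) u = inner (inv a y) y"
      proof -
        have "inner (T u) u = inner (Q (T u)) u" by (rule inner_Q_left[OF u, symmetric])
        also have "\<dots> = inner y u" using \<open>Q (T u) = y\<close> by simp
        also have "\<dots> = inner (Q (inv a y)) y" by (simp add: u_def inner_commute)
        also have "\<dots> = inner (inv a y) y" by (rule inner_Q_left[OF y])
        finally show ?thesis .
      qed
      ultimately show "1 / \<beta> * (norm y)\<^sup>2 \<le> inner (inv a y) y" using * u by metis
    qed
    finally show ?thesis .
  qed
  have bnd: "\<exists>K. \<forall>x\<in>U. norm (S x) \<le> K * norm x" if "bounded_clinear S" for S :: "'a \<Rightarrow> 'a" and U
    using bounded_linear.bounded[of S] that by (auto simp: bounded_clinear_def mult.commute)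
  have c5: "bop_norm R1 (compose R1
        (bop_inv R0 R0 (block R0 R0 a))
        (block R0 R1 a)) \<le> \<beta>
      \<longleftrightarrow> (\<forall>u. P u = 0 \<longrightarrow> norm (P (T u)) \<le> \<beta> * norm u)"
    unfolding inv_block_R0_R1[OF ctx]
    using pos bnd[OF bounded_clinear_compose[OF clin T], of R1]
    by (subst bop_norm_le_iff) (auto simp: mem T_def P.zero)
  have c6: "bop_norm R0 (compose R0 (block R1 R0 a)
        (bop_inv R0 R0 (block R0 R0 a))) \<le> \<beta>
      \<longleftrightarrow> (\<forall>u. P u = u \<longrightarrow> norm (Q (T u)) \<le> \<beta> * norm u)"
    unfolding block_R1_R0_inv[OF ctx]
    using pos bnd[OF bounded_clinear_compose[OF clin_Q T], of R0]
    by (subst bop_norm_le_iff) (auto simp: mem T_def P.zero)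
  have inv: "continuously_invertible UNIV UNIV a \<longleftrightarrow> bij a \<and> bounded_clinear (inv a)"
    by (simp add: continuously_invertible_def bop_inv_def bounded_ops_UNIV_iff bij_betw_def bij_def
        restrict_def)
  have inv_eq: "bop_inv UNIV UNIV a = inv a" by (simp add: bop_inv_def restrict_def)
  show ?thesis
  proof
    assume "a \<in> M1_class \<alpha> \<beta> A0 A1"
    then have "T \<in> partial_inverse_class \<alpha> \<beta>"
      using c1' c2 c3 c4 c5 c6 T
      by (simp add: M1_class_def M_class_def Let_def ran inv inv_eq partial_inverse_class_def)
    then show "bounded_clinear a \<and> coercive_on_range \<alpha> a \<and> partial_inverse a \<in> partial_inverse_class \<alpha> \<beta>"
      using a c by (simp add: T_def)
  next
    assume "bounded_clinear a \<and> coercive_on_range \<alpha> a \<and> partial_inverse a \<in> partial_inverse_class \<alpha> \<beta>"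
    then have *: "T \<in> partial_inverse_class \<alpha> \<beta>" by (simp add: T_def)
    then have "bij a" "bounded_clinear (inv a)"
      using invertible_if_partial_inverse_class[OF a c _ pos] by (auto simp: T_def)
    then show "a \<in> M1_class \<alpha> \<beta> A0 A1"
      using * c1 c2 c3 c4 c5 c6 a
      by (simp add: M1_class_def M_class_def Let_def ran inv inv_eq bounded_ops_UNIV_iff partial_inverse_class_def)
  qed
qed

lemma partial_inverse_in_M1_class:
  assumes T: "T \<in> partial_inverse_class \<alpha> \<beta>"
  shows "partial_inverse T \<in> M1_class \<alpha> \<beta> A0 A1" "partial_inverse (partial_inverse T) = T"
proof -
  note Tc = partial_inverse_class_coercive[OF T pos(2)]
  have coer: "coercive_on_range \<alpha> (partial_inverse T)"
    by (rule coercive_on_range_partial_inverse[OF T pos])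
  show eq: "partial_inverse (partial_inverse T) = T"
    by (rule partial_inverse_partial_inverse[OF Tc coer])
  show "partial_inverse T \<in> M1_class \<alpha> \<beta> A0 A1"
    using coer T by (simp add: M1_class_iff eq bounded_clinear_partial_inverse[OF Tc])
qed

section \<open>The topology in terms of the partial inverse\<close>

lemma tau_H_eq:
  "tau_H \<alpha> \<beta> A0 A1 = initial_topology (M_class \<alpha> \<beta> A0 A1)
    {(schur00 R0, weak_op_topology R0 R0),
     (schur10 R0 R1, weak_op_topology R0 R1),
     (schur01 R0 R1, weak_op_topology R1 R0),
     (schur11 R0 R1, weak_op_topology R1 R1)}"
  by (simp add: tau_H_def Let_def ran schur00_def[abs_def] schur10_def[abs_def]
      schur01_def[abs_def] schur11_def[abs_def])

lemma topspace_tau_H: "topspace (tau_H \<alpha> \<beta> A0 A1) = M_class \<alpha> \<beta> A0 A1"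
  by (simp add: tau_H_eq)

lemma csubspace_ranges: "csubspace R0" "csubspace R1"
  by (simp_all add: R0 R1 csubspace_fixed csubspace_null)

lemma blocks_bounded_ops:
  assumes T: "bounded_clinear T"
  shows "(\<lambda>u\<in>R0. P (T u)) \<in> bounded_ops R0 R0"
    "(\<lambda>u\<in>R0. Q (T u)) \<in> bounded_ops R0 R1"
    "(\<lambda>u\<in>R1. - P (T u)) \<in> bounded_ops R1 R0"
    "(\<lambda>u\<in>R1. Q (T u)) \<in> bounded_ops R1 R1"
proof -
  note PT = bounded_clinear_compose[OF clin T] and QT = bounded_clinear_compose[OF clin_Q T]
  have "bounded_clinear (\<lambda>u. P (T u) - P (T u) - P (T u))"
    by (rule bounded_clinear_diff[OF bounded_clinear_diff[OF PT PT] PT])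
  then have NPT: "bounded_clinear (\<lambda>u. - P (T u))" by simp
  show "(\<lambda>u\<in>R0. P (T u)) \<in> bounded_ops R0 R0"
    by (rule restrict_bounded_ops[OF PT csubspace_ranges(1)]) (simp add: R0_iff[OF R0 R1] R1_iff[OF R0 R1])
  show "(\<lambda>u\<in>R0. Q (T u)) \<in> bounded_ops R0 R1"
    by (rule restrict_bounded_ops[OF QT csubspace_ranges(1)]) (simp add: R0_iff[OF R0 R1] R1_iff[OF R0 R1] P.diff)
  show "(\<lambda>u\<in>R1. - P (T u)) \<in> bounded_ops R1 R0"
    by (rule restrict_bounded_ops[OF NPT csubspace_ranges(2)]) (simp add: R0_iff[OF R0 R1] R1_iff[OF R0 R1] P.neg)
  show "(\<lambda>u\<in>R1. Q (T u)) \<in> bounded_ops R1 R1"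
    by (rule restrict_bounded_ops[OF QT csubspace_ranges(2)]) (simp add: R0_iff[OF R0 R1] R1_iff[OF R0 R1] P.diff)
qed

lemma M_class_blocks:
  assumes "a \<in> M_class \<alpha> \<beta> A0 A1"
  shows
    "schur00 R0 a = (\<lambda>u\<in>R0. P (partial_inverse a u))"
    "schur10 R0 R1 a = (\<lambda>u\<in>R0. Q (partial_inverse a u))"
    "schur01 R0 R1 a = (\<lambda>u\<in>R1. - P (partial_inverse a u))"
    "schur11 R0 R1 a = (\<lambda>u\<in>R1. Q (partial_inverse a u))"
  unfolding schur00_def schur10_def schur01_def schur11_def
  using M_class_imp[OF assms] inv_block_R0_R0[OF R0 R1] block_R1_R0_inv[OF R0 R1]
    inv_block_R0_R1[OF R0 R1] Schur_complement[OF R0 R1] by blast+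

text \<open>This lemma and the next one say that \<^const>\<open>tau_H\<close> is the initial topology for the coefficients of
  the partial inverse: these are sums of coefficients of the four blocks, and conversely each
  block is a corner of the partial inverse.\<close>

lemma continuous_map_tau_H_coefficient:
  "continuous_map (tau_H \<alpha> \<beta> A0 A1) euclidean (\<lambda>a. inner (partial_inverse a x) y)"
proof -
  let ?X = "tau_H \<alpha> \<beta> A0 A1"
  have T: "bounded_clinear (partial_inverse a)" if "a \<in> M_class \<alpha> \<beta> A0 A1" for a
    using bounded_clinear_partial_inverse M_class_imp[OF that] by blast
  have coefficient: "continuous_map ?X euclidean (\<lambda>a. inner (f a x) y)"
    if "continuous_map ?X (weak_op_topology U V) f" "x \<in> U" "y \<in> V" for f U V x y
  proof -
    have "continuous_map ?X euclidean ((\<lambda>T. cinner (T x) y) \<circ> f)"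
      by (rule continuous_map_compose[OF that(1) continuous_map_weak_op_coefficient[OF that(2,3)]])
    moreover have "continuous_map euclidean euclidean Re"
      by (simp add: continuous_on_Re)
    ultimately have "continuous_map ?X euclidean (Re \<circ> ((\<lambda>T. cinner (T x) y) \<circ> f))"
      by (rule continuous_map_compose)
    then show ?thesis by (simp add: comp_def Re_cinner)
  qed
  have proj: "continuous_map ?X (weak_op_topology R0 R0) (schur00 R0)"
    "continuous_map ?X (weak_op_topology R0 R1) (schur10 R0 R1)"
    "continuous_map ?X (weak_op_topology R1 R0) (schur01 R0 R1)"
    "continuous_map ?X (weak_op_topology R1 R1) (schur11 R0 R1)"
    unfolding tau_H_eq
    by (rule continuous_map_initial_topology, simp,
        simp add: Pi_iff M_class_blocks blocks_bounded_ops T del: restrict_apply)+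
  have in0: "P z \<in> R0" and in1: "Q z \<in> R1" for z
    by (simp_all add: R0_iff[OF R0 R1] R1_iff[OF R0 R1] P.diff)
  let ?g = "\<lambda>a. inner (schur00 R0 a (P x)) (P y)
    + inner (schur10 R0 R1 a (P x)) (Q y)
    - inner (schur01 R0 R1 a (Q x)) (P y)
    + inner (schur11 R0 R1 a (Q x)) (Q y)"
  have "continuous_map ?X euclidean ?g"
    by (intro continuous_map_add continuous_map_diff coefficient[OF proj(1) in0 in0]
        coefficient[OF proj(2) in0 in1] coefficient[OF proj(3) in1 in0] coefficient[OF proj(4) in1 in1])
  moreover have "?g a = inner (partial_inverse a x) y" if "a \<in> topspace ?X" for a
  proof -
    have a: "a \<in> M_class \<alpha> \<beta> A0 A1" using that by (simp add: topspace_tau_H)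
    interpret T: bounded_linear "partial_inverse a" using T[OF a] by (simp add: bounded_clinear_def)
    let ?T = "partial_inverse a"
    have "?g a = inner (P (?T (P x))) (P y) + inner (Q (?T (P x))) (Q y)
        - inner (- P (?T (Q x))) (P y) + inner (Q (?T (Q x))) (Q y)"
      unfolding M_class_blocks[OF a] using in0 in1 by simp
    also have "\<dots> = inner (?T x) y"
      by (simp add: T.diff P.diff inner_diff_left inner_diff_right selfadjoint)
    finally show ?thesis .
  qed
  ultimately show ?thesis by (rule continuous_map_eq)
qed

lemma continuous_map_into_tau_H:
  fixes g :: "'z \<Rightarrow> 'a \<Rightarrow> 'a"
  assumes g: "g \<in> topspace Z \<rightarrow> M_class \<alpha> \<beta> A0 A1"
    and cont: "\<And>x y. continuous_map Z euclidean (\<lambda>z. inner (partial_inverse (g z) x) y)"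
  shows "continuous_map Z (tau_H \<alpha> \<beta> A0 A1) g"
proof -
  have gM: "g z \<in> M_class \<alpha> \<beta> A0 A1" if "z \<in> topspace Z" for z using g that by auto
  have T: "bounded_clinear (partial_inverse (g z))" if "z \<in> topspace Z" for z
    using bounded_clinear_partial_inverse M_class_imp[OF gM[OF that]] by blast
  \<comment> \<open>The imaginary part of a coefficient at \<open>x\<close> is minus the real part of the one at \<open>\<i> *\<^sub>C x\<close>.\<close>
  have cinner: "continuous_map Z euclidean (\<lambda>z. cinner (S z x) y)"
    if "\<And>x y. continuous_map Z euclidean (\<lambda>z. inner (S z x) y)"
      and "\<And>z. z \<in> topspace Z \<Longrightarrow> S z (\<i> *\<^sub>C x) = \<i> *\<^sub>C S z x" for S :: "'z \<Rightarrow> 'a \<Rightarrow> 'a" and x y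
  proof (rule continuous_map_eq)
    show "continuous_map Z euclidean
        (\<lambda>z. complex_of_real (inner (S z x) y) - \<i> * complex_of_real (inner (S z (\<i> *\<^sub>C x)) y))"
    proof -
      have "continuous_map Z euclidean (complex_of_real \<circ> (\<lambda>z. inner (S z x) y))"
        by (rule continuous_map_compose[OF that(1)]) (simp add: continuous_on_of_real)
      moreover have "continuous_map Z euclidean
          ((\<lambda>r. \<i> * complex_of_real r) \<circ> (\<lambda>z. inner (S z (\<i> *\<^sub>C x)) y))"
        by (rule continuous_map_compose[OF that(1)]) (simp add: continuous_on_of_real continuous_on_mult_left)
      ultimately show ?thesis unfolding comp_def by (rule continuous_map_diff)
    qed
    show "complex_of_real (inner (S z x) y) - \<i> * complex_of_real (inner (S z (\<i> *\<^sub>C x)) y) = cinner (S z x) y"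
      if "z \<in> topspace Z" for z
      using \<open>\<And>z. z \<in> topspace Z \<Longrightarrow> S z (\<i> *\<^sub>C x) = \<i> *\<^sub>C S z x\<close>[OF that]
      by (simp add: cinner_eq_Complex_inner complex_eq_iff)
  qed
  have PT: "continuous_map Z euclidean (\<lambda>z. inner (P (partial_inverse (g z) x)) y)" for x y
    unfolding selfadjoint by (rule cont)
  have QT: "continuous_map Z euclidean (\<lambda>z. inner (Q (partial_inverse (g z) x)) y)" for x y
    unfolding inner_diff_left by (intro continuous_map_diff cont PT)
  have NPT: "continuous_map Z euclidean (\<lambda>z. inner (- P (partial_inverse (g z) x)) y)" for x y
    unfolding inner_minus_left by (intro continuous_map_minus PT)
  have lin: "partial_inverse (g z) (\<i> *\<^sub>C x) = \<i> *\<^sub>C partial_inverse (g z) x" if "z \<in> topspace Z" for z x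
    by (rule bounded_clinear_scaleC[OF T[OF that]])
  note linP = bounded_clinear_scaleC[OF clin]
  have block: "continuous_map Z (weak_op_topology U V) (\<lambda>z. F (g z))"
    if "\<And>z. z \<in> topspace Z \<Longrightarrow> F (g z) = (\<lambda>u\<in>U. S z u)"
      "\<And>z. z \<in> topspace Z \<Longrightarrow> (\<lambda>u\<in>U. S z u) \<in> bounded_ops U V"
      "\<And>x y. continuous_map Z euclidean (\<lambda>z. cinner (S z x) y)" for F U V and S :: "'z \<Rightarrow> 'a \<Rightarrow> 'a"
  proof (rule continuous_map_into_weak_op_topology)
    show "(\<lambda>z. F (g z)) \<in> topspace Z \<rightarrow> bounded_ops U V" using that(1,2) by auto
    fix x y assume "x \<in> U"
    then show "continuous_map Z euclidean (\<lambda>z. cinner (F (g z) x) y)"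
      by (intro continuous_map_eq[OF that(3)[of x y]]) (simp add: that(1))
  qed
  show ?thesis
    unfolding tau_H_eq
  proof (rule continuous_map_into_initial_topology[OF g])
    fix f Y
    assume "(f, Y) \<in> {(schur00 R0, weak_op_topology R0 R0),
     (schur10 R0 R1, weak_op_topology R0 R1),
     (schur01 R0 R1, weak_op_topology R1 R0),
     (schur11 R0 R1, weak_op_topology R1 R1)}"
    then consider
      "f = schur00 R0" "Y = weak_op_topology R0 R0"
    | "f = schur10 R0 R1" "Y = weak_op_topology R0 R1"
    | "f = schur01 R0 R1" "Y = weak_op_topology R1 R0"
    | "f = schur11 R0 R1" "Y = weak_op_topology R1 R1"
      by blast
    then show "continuous_map Z Y (\<lambda>z. f (g z))"
    proof cases
      case 1
      show ?thesis unfolding 1(2)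
        by (rule block[where S = "\<lambda>z u. P (partial_inverse (g z) u)"])
          (use gM T in \<open>auto simp: 1(1) M_class_blocks blocks_bounded_ops lin linP intro!: cinner PT\<close>)
    next
      case 2
      show ?thesis unfolding 2(2)
        by (rule block[where S = "\<lambda>z u. Q (partial_inverse (g z) u)"])
          (use gM T in \<open>auto simp: 2(1) M_class_blocks blocks_bounded_ops lin linP scaleC_diff_right intro!: cinner QT\<close>)
    next
      case 3
      show ?thesis unfolding 3(2)
        by (rule block[where S = "\<lambda>z u. - P (partial_inverse (g z) u)"])
          (use gM T in \<open>auto simp: 3(1) M_class_blocks blocks_bounded_ops lin linP scaleC_minus_right intro!: cinner NPT\<close>)
    next
      case 4
      show ?thesis unfolding 4(2)
        by (rule block[where S = "\<lambda>z u. Q (partial_inverse (g z) u)"])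
          (use gM T in \<open>auto simp: 4(1) M_class_blocks blocks_bounded_ops lin linP scaleC_diff_right intro!: cinner QT\<close>)
    qed
  qed
qed

text \<open>The coordinates of the partial inverse with respect to a countable dense set are a homeomorphism
  onto a compact subset of a metric space.\<close>

lemma M1_class_metrizable_seq_compact:
  assumes S: "countable S" "closure S = (UNIV :: 'a set)"
  shows "metrizable_space (subtopology (tau_H \<alpha> \<beta> A0 A1) (M1_class \<alpha> \<beta> A0 A1))"
    "seq_compact_space (subtopology (tau_H \<alpha> \<beta> A0 A1) (M1_class \<alpha> \<beta> A0 A1))"
proof -
  let ?M = "M1_class \<alpha> \<beta> A0 A1" and ?\<T> = "partial_inverse_class \<alpha> \<beta>"
  let ?X = "subtopology (tau_H \<alpha> \<beta> A0 A1) ?M"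
  obtain \<Phi> :: "('a \<Rightarrow> 'a) \<Rightarrow> nat \<times> nat \<Rightarrow> real" where inj: "inj_on \<Phi> ?\<T>"
    and comp: "compact (\<Phi> ` ?\<T>)" and coord: "\<And>k. \<exists>x y. \<forall>T. \<Phi> T k = inner (T x) y"
    and cont: "\<And>x y. continuous_on (\<Phi> ` ?\<T>) (\<lambda>v. inner (inv_into ?\<T> \<Phi> v x) y)"
  proof (rule weak_coordinates[OF _ _ _ S, of ?\<T> "1 / \<alpha> + 3 * \<beta>"])
    show "S' \<in> ?\<T>" if "range T \<subseteq> ?\<T>" "bounded_linear S'"
      "\<And>x y. (\<lambda>n::nat. inner (T n x) y) \<longlonglongrightarrow> inner (S' x) y" for T S'
      by (rule partial_inverse_class_weakly_closed[OF pos _ that(2,3)]) (use that(1) in auto)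
  qed (auto simp: partial_inverse_class_norm_le[OF _ pos] partial_inverse_class_def bounded_clinear_def)
  have MM: "?M \<subseteq> M_class \<alpha> \<beta> A0 A1" by (auto simp: M1_class_def Let_def)
  then have top: "topspace ?X = ?M" by (auto simp: topspace_tau_H)
  have "homeomorphic_maps ?X (top_of_set (\<Phi> ` ?\<T>)) (\<lambda>a. \<Phi> (partial_inverse a))
      (\<lambda>v. partial_inverse (inv_into ?\<T> \<Phi> v))"
    unfolding homeomorphic_maps_def
  proof (intro conjI ballI)
    show "continuous_map ?X (top_of_set (\<Phi> ` ?\<T>)) (\<lambda>a. \<Phi> (partial_inverse a))"
    proof (rule continuous_map_into_subtopology)
      have "continuous_map ?X euclidean (\<lambda>a. \<Phi> (partial_inverse a) k)" for k
      proof -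
        obtain x y where "\<And>T. \<Phi> T k = inner (T x) y" using coord by blast
        then show ?thesis
          using continuous_map_from_subtopology[OF continuous_map_tau_H_coefficient] by simp
      qed
      then show "continuous_map ?X euclidean (\<lambda>a. \<Phi> (partial_inverse a))"
        by (simp add: continuous_map_componentwise_UNIV flip: euclidean_product_topology)
    qed (unfold top, use M1_class_iff in auto)
    have v: "inv_into ?\<T> \<Phi> v \<in> ?\<T>" if "v \<in> \<Phi> ` ?\<T>" for v using that by (rule inv_into_into)
    show "continuous_map (top_of_set (\<Phi> ` ?\<T>)) ?X (\<lambda>v. partial_inverse (inv_into ?\<T> \<Phi> v))"
    proof (rule continuous_map_into_subtopology[OF continuous_map_into_tau_H])
      show *: "(\<lambda>v. partial_inverse (inv_into ?\<T> \<Phi> v)) \<in> topspace (top_of_set (\<Phi> ` ?\<T>)) \<rightarrow> ?M"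
        using partial_inverse_in_M1_class(1)[OF v] by auto
      then show "(\<lambda>v. partial_inverse (inv_into ?\<T> \<Phi> v)) \<in> topspace (top_of_set (\<Phi> ` ?\<T>)) \<rightarrow> M_class \<alpha> \<beta> A0 A1"
        using MM by blast
      show "continuous_map (top_of_set (\<Phi> ` ?\<T>)) euclidean
          (\<lambda>v. inner (partial_inverse (partial_inverse (inv_into ?\<T> \<Phi> v)) x) y)" for x y
        by (rule continuous_map_eq[where f = "\<lambda>v. inner (inv_into ?\<T> \<Phi> v x) y"])
          (use cont partial_inverse_in_M1_class(2)[OF v] in auto)
    qed
    show "partial_inverse (inv_into ?\<T> \<Phi> (\<Phi> (partial_inverse a))) = a" if "a \<in> topspace ?X" for a
    proof -
      have a: "bounded_clinear a" "coercive_on_range \<alpha> a" "partial_inverse a \<in> ?\<T>"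
        using that M1_class_iff by (auto simp: top)
      show ?thesis
        unfolding inv_into_f_f[OF inj a(3)]
        by (rule partial_inverse_partial_inverse[OF a(1,2) partial_inverse_class_coercive(2)[OF a(3) pos(2)]])
    qed
    show "\<Phi> (partial_inverse (partial_inverse (inv_into ?\<T> \<Phi> v))) = v"
      if "v \<in> topspace (top_of_set (\<Phi> ` ?\<T>))" for v
      using that partial_inverse_in_M1_class(2)[OF v, of v] by (simp add: f_inv_into_f)
  qed
  then show "metrizable_space ?X" "seq_compact_space ?X"
    using metrizable_seq_compact_if_homeomorphic_compact[OF _ comp] by auto
qed

end

end

theorem theorem5p10:
  fixes A0 :: "('a::chilbert_space \<times> 'b::chilbert_space) set"
    and A1 :: "('b \<times> 'c::chilbert_space) set"
    and \<alpha> \<beta> :: real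
  assumes "linear_operator A0" and "densely_defined A0" and "closed A0"
    and "linear_operator A1" and "densely_defined A1" and "closed A1"
    and "closed_exact A0 A1"
    and "\<exists>S :: 'b set. countable S \<and> closure S = UNIV"
    and "\<alpha> > 0" and "\<beta> > 0"
  shows "metrizable_space (subtopology (tau_H \<alpha> \<beta> A0 A1) (M1_class \<alpha> \<beta> A0 A1)) \<and>
    seq_compact_space (subtopology (tau_H \<alpha> \<beta> A0 A1) (M1_class \<alpha> \<beta> A0 A1))"
proof -
  have exact: "closed (Range A0)" "closed (Range A1)" "Range A0 = op_ker A1"
    using assms(7) unfolding closed_exact_def by blast+
  have sub: "csubspace (Range A0)"
    using assms(4) unfolding exact(3) csubspace_def op_ker_def linear_operator_def
    by clarsimp (metis add_0 scaleC_zero_right)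
  obtain P where P: "orthogonal_projection P" "Range A0 = {x. P x = x}"
    "{z. \<forall>x\<in>Range A0. inner x z = 0} = {x. P x = 0}"
    by (rule csubspace_orthogonal_projection[OF sub exact(1)])
  have "Range (op_adjoint A1) = {x. P x = 0}"
    using P(3) unfolding Range_op_adjoint_eq_orthogonal_ker[OF assms(4,6) exact(2)] exact(3) .
  moreover obtain S :: "'b set" where "countable S" "closure S = UNIV" using assms(8) by blast
  ultimately show ?thesis
    using orthogonal_projection.M1_class_metrizable_seq_compact[OF P(1) refl _ P(2) refl assms(9,10)] by blast
qed

end
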